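(* Let $N:(0,\infty)\to\mathbb{R}$ be a nondecreasing function such that $N(\lambda)=0$ for all sufficiently small $\lambda>0$ and $\int_0^\infty \lambda^{-1}\,dN(\lambda)<\infty$. Let $\zeta_0=\lambda_0+i\eta_0$ with $\lambda_0>0$, $\eta_0>0$, and suppose that $N$ is constant in a neighbourhood of $\lambda_0$. Let $\Gamma$ be a contour in $\mathbb{C}$ connecting $\overline{\zeta_0}=\lambda_0-i\eta_0$ to $\zeta_0$, oriented from $\overline{\zeta_0}$ to $\zeta_0$, which does not cross $\mathbb{R}_+=(0,+\infty)$. Then for every $\alpha>0$ $$\left|N^{(\alpha)}(\lambda_0)-\frac{1}{2\pi i}\int_\Gamma S(\zeta)\left(1-\frac{\zeta}{\lambda_0}\right)^{\alpha}d\zeta\right|\le \frac{1}{\alpha\pi}\left(\frac{\eta_0}{\lambda_0}\right)^{\alpha}\eta_0\,|S(\zeta_0)|.$$ Moreover, for $0<\alpha<1$ the factor $\frac{1}{\alpha\pi}$ on the right-hand side may be replaced by $\sqrt{\pi^{-2}+1/4}$; that is, the inequality with this replacement also holds.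
   Context: Integrals with respect to $dN$ are Stieltjes integrals. The Stieltjes transform of $N$ is $$S(\zeta)=\int_0^\infty(\lambda-\zeta)^{-1}\,dN(\lambda),\qquad \zeta\in\mathbb{C}\setminus\mathbb{R}_+ .$$ For $\alpha>0$ the Riesz mean of order $\alpha$ of $N$ is $$N^{(\alpha)}(\lambda)=\int_0^\lambda\left(1-\frac{x}{\lambda}\right)^{\alpha}dN(x),\qquad \lambda>0 .$$ Powers use the branch $z^\alpha=\exp(\alpha\ln z)$ with $-\pi<\mathrm{Im}\,\ln z\le\pi$. A contour means a piecewise smooth path; "does not cross $\mathbb{R}_+$" means it lies in $\mathbb{C}\setminus\mathbb{R}_+$. *)

theory Defs
  imports "HOL-Complex_Analysis.Complex_Analysis"
begin

text \<open>
  The measure \<open>dN\<close> of a nondecreasing function \<open>N\<close> on \<open>(0,\<infinity>)\<close> whose limit \<open>N(0+)\<close> is finite.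
  Values of \<open>N\<close> outside \<open>(0,\<infinity>)\<close> are ignored. \<^const>\<open>interval_measure\<close> needs a right-continuous
  distribution function and \<open>N\<close> need not be one, so \<open>N\<close> enters through its right limits \<open>N(x+)\<close>
  (and \<open>N(0+)\<close> for \<open>x \<le> 0\<close>, so no mass lies outside \<open>(0,\<infinity>)\<close>). This does not affect
  Stieltjes integrals of continuous integrands, except through the value of the integrand at an
  endpoint of the interval of integration where \<open>N\<close> jumps; the integrand of a Riesz mean
  vanishes at its upper endpoint.
\<close>

definition stieltjes_measure :: "(real \<Rightarrow> real) \<Rightarrow> real measure" where
  "stieltjes_measure N = interval_measure (\<lambda>x. Lim (at_right (max x 0)) N)"

definition stieltjes_transform :: "(real \<Rightarrow> real) \<Rightarrow> complex \<Rightarrow> complex" where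
  "stieltjes_transform N \<zeta> =
     (LINT x:{0<..}|stieltjes_measure N. inverse (complex_of_real x - \<zeta>))"

definition riesz_mean :: "(real \<Rightarrow> real) \<Rightarrow> real \<Rightarrow> real \<Rightarrow> real" where
  "riesz_mean N \<alpha> l = (LINT x:{0<..l}|stieltjes_measure N. (1 - x / l) powr \<alpha>)"

end

theory Submission
  imports Defs
begin

text \<open>
  Let \<open>f(\<zeta>) = (1 - \<zeta>/l)\<^sup>\<alpha>\<close>. By Fubini and Cauchy's formula in the half-plane \<open>Re \<zeta> \<le> l\<close>, replacing
  \<open>\<Gamma>\<close> by the vertical segment from \<open>cnj \<zeta>\<^sub>0\<close> to \<open>\<zeta>\<^sub>0\<close> (which avoids the support of \<open>dN\<close>) produces
  exactly the Riesz mean. By symmetry the remaining error is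
  \<open>-(\<eta>\<^sub>0/\<pi>) Re \<integral>\<^sub>0\<^sup>1 S(l + i\<eta>\<^sub>0u) f(l + i\<eta>\<^sub>0u) du\<close>.
  Since \<open>\<eta> |S(l + i\<eta>)|\<close> is nondecreasing in \<open>\<eta>\<close>, the integrand is dominated by a multiple of
  \<open>u\<^sup>\<alpha>\<^sup>-\<^sup>1\<close>, which gives the factor \<open>1/\<alpha>\<pi>\<close>. For \<open>\<alpha> < 1\<close> exchange the integrals instead: with
  \<open>\<theta> = \<pi>\<alpha>/2\<close> and \<open>s = (x - l)/\<eta>\<^sub>0\<close> the inner integral
  \<open>E(s) = \<integral>\<^sub>0\<^sup>1 u\<^sup>\<alpha> (s cos \<theta> + u sin \<theta>)/(s\<^sup>2 + u\<^sup>2) du\<close> differs from \<open>cos \<theta>/(\<alpha>+1) \<cdot> s/(s\<^sup>2+1)\<close> by at most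
  \<open>sin \<theta>/\<alpha> \<cdot> 1/(s\<^sup>2+1)\<close>. Hence the error is bounded by \<open>|Re S(\<zeta>\<^sub>0)| + \<pi>/2 |Im S(\<zeta>\<^sub>0)|\<close> up to the
  common factor, and Cauchy--Schwarz concludes.
\<close>

section \<open>The kernel on a vertical segment\<close>

text \<open>The range of \<open>\<phi>\<close> is that of the principal branch, so
  \<open>Ln (cis \<phi>)\<close> is exactly \<open>\<i> * \<phi>\<close> and no multiple of 2 pi i
  enters.\<close>

lemma powr_rcis:
  fixes r \<phi> \<alpha> :: real
  assumes "r \<ge> 0" "-pi < \<phi>" "\<phi> \<le> pi"
  shows "(of_real r * cis \<phi>) powr of_real \<alpha> = of_real (r powr \<alpha>) * cis (\<alpha> * \<phi>)"
proof -
  have "cis \<phi> powr of_real \<alpha> = cis (\<alpha> * \<phi>)"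
    using assms by (simp add: powr_def Ln_cis cis_conv_exp mult_ac)
  then show ?thesis using assms by (simp add: powr_times_real_left powr_of_real)
qed

lemma has_integral_contour_integral_linepath:
  assumes "f contour_integrable_on linepath a b"
  shows "((\<lambda>u. f (a + of_real u * (b - a)) * (b - a)) has_integral contour_integral (linepath a b) f) {0..1}"
proof -
  have "linepath a b u = a + of_real u * (b - a)" for u
    by (simp add: linepath_def scaleR_conv_of_real algebra_simps)
  then show ?thesis
    using has_contour_integral_integral[OF assms] by (simp add: has_contour_integral_linepath)
qed

text \<open>The bound is the value at t = 0. After clearing |t + cis \<phi>|^2, the right side
  exceeds the left by t^2 cos(\<alpha>\<phi>) + t cos((1 - \<alpha>)\<phi>), and both angles lie in
  the first quadrant.\<close>

lemma Re_quarter_arc_le: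
  fixes t \<alpha> \<phi> :: real
  assumes t: "t > 0" and a: "0 < \<alpha>" "\<alpha> < 1" and p: "0 \<le> \<phi>" "\<phi> \<le> pi / 2"
  shows "Re (cis (\<alpha> * \<phi>) * cis \<phi> / (of_real t + cis \<phi>)) \<le> cos (\<alpha> * \<phi>)"
proof -
  have c: "cos \<phi> \<ge> 0" using p by (intro cos_ge_zero) auto
  have s: "sin \<phi> \<ge> 0" using p by (intro sin_ge_zero) auto
  have ap: "0 \<le> \<alpha> * \<phi>" "\<alpha> * \<phi> \<le> \<phi>" using a p by (auto intro: mult_left_le_one_le)
  have c': "cos (\<alpha> * \<phi>) \<ge> 0" using p ap by (intro cos_ge_zero) auto
  have s': "sin (\<alpha> * \<phi>) \<ge> 0" using p ap by (intro sin_ge_zero) auto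
  have n: "(t + cos \<phi>)\<^sup>2 + (sin \<phi>)\<^sup>2 > 0"
    using t c by (intro add_pos_nonneg) auto
  have cs: "(cos \<phi>)\<^sup>2 + (sin \<phi>)\<^sup>2 = 1" by simp
  have cs2: "cos \<phi> * (cos \<phi> * x) + sin \<phi> * (sin \<phi> * x) = x" for x
    using cs by (metis distrib_right mult.assoc mult_1 power2_eq_square)
  have "Re (cis (\<alpha> * \<phi>) * cis \<phi> / (of_real t + cis \<phi>))
     = (t * (cos (\<alpha>*\<phi>) * cos \<phi> - sin (\<alpha>*\<phi>) * sin \<phi>) + cos (\<alpha>*\<phi>) * ((cos \<phi>)\<^sup>2 + (sin \<phi>)\<^sup>2)) / ((t + cos \<phi>)\<^sup>2 + (sin \<phi>)\<^sup>2)"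
    by (simp add: Re_divide power2_eq_square) (simp add: algebra_simps cs2)
  also have "\<dots> \<le> cos (\<alpha>*\<phi>)"
  proof -
    have "(t + cos \<phi>)\<^sup>2 + (sin \<phi>)\<^sup>2 = t\<^sup>2 + 2 * t * cos \<phi> + 1"
      using cs by (simp add: power2_sum)
    moreover have "t * (cos (\<alpha>*\<phi>) * cos \<phi> - sin (\<alpha>*\<phi>) * sin \<phi>) + cos (\<alpha>*\<phi>)
      \<le> cos (\<alpha>*\<phi>) * (t\<^sup>2 + 2 * t * cos \<phi> + 1)"
    proof -
      have "0 \<le> t * (sin (\<alpha>*\<phi>) * sin \<phi>) + t * (cos (\<alpha>*\<phi>) * cos \<phi>) + cos (\<alpha>*\<phi>) * t\<^sup>2"
        using t c s c' s' by simp
      then show ?thesis by (simp add: algebra_simps)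
    qed
    ultimately show ?thesis using n cs by (simp add: divide_le_eq)
  qed
  finally show ?thesis .
qed

text \<open>
  The integral is the imaginary part of \<open>\<integral> z\<^sup>\<alpha>/(t + z) dz\<close> from \<open>0\<close> to \<open>\<i>\<close>. Moving the path to
  \<open>[0,1]\<close>, where the integrand is real, followed by the quarter circle leaves only the arc.
\<close>

lemma integral_vertical_kernel_le:
  fixes t \<alpha> :: real
  assumes t: "t > 0" and a: "0 < \<alpha>" "\<alpha> < 1"
  defines "\<theta> \<equiv> pi * \<alpha> / 2"
  shows "integral {0..1} (\<lambda>u. u powr \<alpha> * (t * cos \<theta> + u * sin \<theta>) / (t\<^sup>2 + u\<^sup>2)) \<le> sin \<theta> / \<alpha>"
proof -
  define f where "f = (\<lambda>z. z powr of_real \<alpha> / (of_real t + z) :: complex)"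
  define H where "H = {z::complex. Re z \<ge> 0}"
  define g where "g = linepath 0 1 +++ part_circlepath 0 1 0 (pi/2) +++ linepath \<i> 0"
  have nz: "of_real t + z \<noteq> 0" if "z \<in> H" for z :: complex
  proof
    assume "of_real t + z = 0"
    then have "Re (of_real t + z) = 0" by (metis zero_complex.sel(1))
    then show False using that t by (simp add: H_def)
  qed
  have convH: "convex H" unfolding H_def by (rule convex_halfspace_Re_ge)
  \<comment> \<open>The branch point 0 lies on the boundary of \<open>H\<close>: there
    \<open>f\<close> is continuous because \<alpha> > 0, and Cauchy's theorem on a convex set asks
    for differentiability in the interior only.\<close>
  have contf: "continuous_on H f"
    unfolding f_def using a nz by (intro continuous_intros) (auto simp: H_def)
  have "interior H = {z. Re z > 0}"
    using interior_halfspace_ge[of "1::complex" 0] by (simp add: H_def inner_complex_def)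
  moreover have "f holomorphic_on {z. Re z > 0}"
    unfolding f_def using nz by (intro holomorphic_intros) (auto simp: H_def complex_nonpos_Reals_iff)
  ultimately have holf: "f field_differentiable at z" if "z \<in> interior H - {}" for z
    using that holomorphic_on_imp_differentiable_at open_halfspace_Re_gt by blast
  have "exp (\<i> * of_real pi / 2) = \<i>"
    using cis_conv_exp[of "pi / 2"] by simp
  then have fin: "pathfinish (part_circlepath 0 1 0 (pi/2)) = \<i>" "pathstart (part_circlepath 0 1 0 (pi/2)) = 1"
    by simp_all
  have im3: "path_image (linepath \<i> 0) \<subseteq> H" "path_image (linepath 0 1) \<subseteq> H"
    by (auto simp: H_def closed_segment_def)
  have im2: "path_image (part_circlepath 0 1 0 (pi/2)) \<subseteq> H"
    by (auto simp: H_def path_image_part_circlepath simp flip: cis_conv_exp intro!: cos_ge_zero)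
  have conti: "f contour_integrable_on linepath 0 1" "f contour_integrable_on part_circlepath 0 1 0 (pi/2)"
     "f contour_integrable_on linepath \<i> 0"
    using contf im2 im3
    by (auto intro!: contour_integrable_continuous_linepath contour_integrable_continuous_part_circlepath intro: continuous_on_subset)
  have "(f has_contour_integral 0) g"
    by (rule Cauchy_theorem_convex[OF contf convH finite.emptyI holf])
      (use im2 im3 fin in \<open>auto simp: g_def path_image_join valid_path_join simp del: pathstart_part_circlepath pathfinish_part_circlepath\<close>)
  then have "contour_integral g f = 0" by (rule contour_integral_unique)
  then have 0: "contour_integral (linepath 0 1) f + (contour_integral (part_circlepath 0 1 0 (pi/2)) f
     + contour_integral (linepath \<i> 0) f) = 0"
    unfolding g_def using conti fin
    by (subst (asm) contour_integral_join; simp add: valid_path_join contour_integrable_join del: pathstart_part_circlepath pathfinish_part_circlepath)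
  have 1: "Im (contour_integral (linepath 0 1) f) = 0"
  proof -
    have "((\<lambda>u. f (of_real u)) has_integral contour_integral (linepath 0 1) f) {0..1}"
      using has_integral_contour_integral_linepath[OF conti(1)] by simp
    then have "((\<lambda>u. Im (f (of_real u))) has_integral Im (contour_integral (linepath 0 1) f)) {0..1}"
      by (rule has_integral_Im)
    moreover have "((\<lambda>u. Im (f (of_real u))) has_integral 0) {0..1}"
      by (rule has_integral_is_0) (simp add: f_def powr_of_real flip: of_real_add of_real_divide)
    ultimately show ?thesis by (rule has_integral_unique)
  qed
  have 2: "Im (contour_integral (part_circlepath 0 1 0 (pi/2)) f) \<le> sin \<theta> / \<alpha>"
  proof -
    have "((\<lambda>\<phi>. f (cis \<phi>) * \<i> * cis \<phi>) has_integral contour_integral (part_circlepath 0 1 0 (pi/2)) f) {0..pi/2}"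
      using has_contour_integral_integral[OF conti(2)]
      by (simp add: has_contour_integral_part_circlepath_iff)
    then have A: "((\<lambda>\<phi>. Im (f (cis \<phi>) * \<i> * cis \<phi>)) has_integral Im (contour_integral (part_circlepath 0 1 0 (pi/2)) f)) {0..pi/2}"
      by (rule has_integral_Im)
    have B: "((\<lambda>\<phi>. cos (\<alpha> * \<phi>)) has_integral (sin (\<alpha> * (pi/2)) / \<alpha> - sin (\<alpha> * 0) / \<alpha>)) {0..pi/2}"
      using a by (intro fundamental_theorem_of_calculus)
        (auto intro!: derivative_eq_intros simp: has_real_derivative_iff_has_vector_derivative[symmetric])
    have "Im (f (cis \<phi>) * \<i> * cis \<phi>) \<le> cos (\<alpha> * \<phi>)" if "\<phi> \<in> {0..pi/2}" for \<phi>
    proof -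
      have "- pi < \<phi>" "\<phi> \<le> pi" using that pi_gt_zero unfolding atLeastAtMost_iff by linarith+
      then have "cis \<phi> powr of_real \<alpha> = cis (\<alpha> * \<phi>)"
        using powr_rcis[of 1 \<phi> \<alpha>] by simp
      then have "f (cis \<phi>) * \<i> * cis \<phi> = \<i> * (cis (\<alpha> * \<phi>) * cis \<phi> / (of_real t + cis \<phi>))"
        by (simp add: f_def)
      then have "Im (f (cis \<phi>) * \<i> * cis \<phi>) = Re (cis (\<alpha> * \<phi>) * cis \<phi> / (of_real t + cis \<phi>))"
        by (simp only: Im_i_times)
      also have "\<dots> \<le> cos (\<alpha> * \<phi>)" using Re_quarter_arc_le[OF t a] that by auto
      finally show ?thesis .
    qed
    from has_integral_le[OF A B this] show ?thesis by (simp add: \<theta>_def mult.commute)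
  qed
  have 3: "Im (contour_integral (linepath \<i> 0) f) = - integral {0..1} (\<lambda>u. u powr \<alpha> * (t * cos \<theta> + u * sin \<theta>) / (t\<^sup>2 + u\<^sup>2))"
  proof -
    have "f contour_integrable_on linepath 0 \<i>" using conti(3)
      by (metis contour_integrable_reversepath reversepath_linepath valid_path_linepath)
    from has_integral_contour_integral_linepath[OF this]
    have "((\<lambda>u. f (of_real u * \<i>) * \<i>) has_integral contour_integral (linepath 0 \<i>) f) {0..1}"
      by simp
    then have A: "((\<lambda>u. Im (f (of_real u * \<i>) * \<i>)) has_integral Im (contour_integral (linepath 0 \<i>) f)) {0..1}"
      by (rule has_integral_Im)
    have "Im (f (of_real u * \<i>) * \<i>) = u powr \<alpha> * (t * cos \<theta> + u * sin \<theta>) / (t\<^sup>2 + u\<^sup>2)" if "u \<in> {0..1}" for u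
    proof (cases "u = 0")
      case False
      then have u: "u > 0" using that by auto
      have "(of_real u * \<i>) powr of_real \<alpha> = of_real (u powr \<alpha>) * cis \<theta>"
        using powr_rcis[of u "pi/2" \<alpha>] u by (simp add: \<theta>_def mult.commute)
      then have "f (of_real u * \<i>) * \<i> = of_real (u powr \<alpha>) * (cis \<theta> * \<i> / (of_real t + of_real u * \<i>))"
        by (simp add: f_def)
      also have "Im \<dots> = u powr \<alpha> * Im (cis \<theta> * \<i> / (of_real t + of_real u * \<i>))"
        by (simp del: times_divide_eq_right)
      also have "Im (cis \<theta> * \<i> / (of_real t + of_real u * \<i>)) = (t * cos \<theta> + u * sin \<theta>) / (t\<^sup>2 + u\<^sup>2)"
        by (simp add: Im_divide algebra_simps)
      finally show ?thesis by simp
    qed (simp add: f_def)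
    then have "Im (contour_integral (linepath 0 \<i>) f) = integral {0..1} (\<lambda>u. u powr \<alpha> * (t * cos \<theta> + u * sin \<theta>) / (t\<^sup>2 + u\<^sup>2))"
      using has_integral_eq[OF _ A] by (metis (no_types, lifting) integral_unique)
    then show ?thesis using contour_integral_reverse_linepath[of 0 \<i> f] contf im3
      by (metis closed_segment_commute continuous_on_subset contour_integral_reverse_linepath path_image_linepath uminus_complex.sel(2))
  qed
  from 0 have "Im (contour_integral (linepath 0 1) f) + (Im (contour_integral (part_circlepath 0 1 0 (pi/2)) f)
     + Im (contour_integral (linepath \<i> 0) f)) = 0"
    by (metis plus_complex.sel(2) zero_complex.sel(2))
  with 1 2 3 show ?thesis by linarith
qed

text \<open>Multiplied by s^2 + 1, the integrand of the difference is dominated pointwise by a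
  convex combination, with weight \<open>\<kappa>\<close>, of sin \<theta> u^(\<alpha>-1) and the
  kernel at |s|. The first integrates to sin \<theta>/\<alpha>, and the second to at most that by
  \<open>integral_vertical_kernel_le\<close>.\<close>

lemma vertical_kernel_estimate:
  fixes s \<alpha> :: real
  assumes s: "s \<noteq> 0" and a: "0 < \<alpha>" "\<alpha> < 1"
  defines "\<theta> \<equiv> pi * \<alpha> / 2"
  shows "\<bar>integral {0..1} (\<lambda>u. u powr \<alpha> * (s * cos \<theta> + u * sin \<theta>) / (s\<^sup>2 + u\<^sup>2))
      - cos \<theta> / (\<alpha> + 1) * (s / (s\<^sup>2 + 1))\<bar> \<le> sin \<theta> / \<alpha> / (s\<^sup>2 + 1)"
proof -
  define t where "t = \<bar>s\<bar>"
  define e where "e = (\<lambda>s u. u powr \<alpha> * (s * cos \<theta> + u * sin \<theta>) / (s\<^sup>2 + u\<^sup>2))"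
  \<comment> \<open>\<open>\<kappa>\<close> is the value of \<open>1 - u\<^sup>2\<close> at the point \<open>u = t tan \<theta>\<close> where \<open>t sin \<theta> - u cos \<theta>\<close> changes sign,
    so that \<open>(1 - u\<^sup>2 - \<kappa>) (t sin \<theta> - u cos \<theta>) \<ge> 0\<close> throughout.\<close>
  define \<kappa> where "\<kappa> = max 0 (1 - (t * tan \<theta>)\<^sup>2)"
  have t: "t > 0" "t\<^sup>2 = s\<^sup>2" using s by (auto simp: t_def)
  have th: "0 < \<theta>" "\<theta> < pi / 2" using a by (auto simp: \<theta>_def)
  have cs: "cos \<theta> > 0" "sin \<theta> > 0" using th by (auto intro: cos_gt_zero sin_gt_zero)
  have k: "0 \<le> \<kappa>" "\<kappa> \<le> 1" by (auto simp: \<kappa>_def)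
  have s2: "s\<^sup>2 + 1 > 0" "s\<^sup>2 + u\<^sup>2 > 0" for u using s by (auto intro: add_nonneg_pos add_pos_nonneg)
  have ie: "e r integrable_on {0..1}" if "r \<noteq> 0" for r
  proof -
    show ?thesis unfolding e_def using a that
      by (intro integrable_continuous_interval continuous_on_powr' continuous_intros) (auto simp: sum_power2_eq_zero_iff)
  qed
  have p: "((\<lambda>u. u powr \<alpha>) has_integral 1 / (\<alpha> + 1)) {0..1}"
    using has_integral_powr_from_0[of \<alpha> 1] a by simp
  have q: "((\<lambda>u. u powr (\<alpha> - 1)) has_integral 1 / \<alpha>) {0..1}"
    using has_integral_powr_from_0[of "\<alpha> - 1" 1] a by simp
  have L: "((\<lambda>u. (s\<^sup>2 + 1) * e s u - cos \<theta> * s * u powr \<alpha>) has_integral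
      ((s\<^sup>2 + 1) * integral {0..1} (e s) - cos \<theta> * s * (1 / (\<alpha> + 1)))) {0..1}"
    using ie[OF s] p by (intro has_integral_diff has_integral_mult_right) auto
  have R: "((\<lambda>u. (1 - \<kappa>) * sin \<theta> * u powr (\<alpha> - 1) + \<kappa> * e t u) has_integral
      ((1 - \<kappa>) * sin \<theta> * (1 / \<alpha>) + \<kappa> * integral {0..1} (e t))) {0..1}"
    using ie[of t] t q by (intro has_integral_add has_integral_mult_right) auto
  have "norm ((s\<^sup>2 + 1) * e s u - cos \<theta> * s * u powr \<alpha>) \<le> (1 - \<kappa>) * sin \<theta> * u powr (\<alpha> - 1) + \<kappa> * e t u"
    if "u \<in> {0..1}" for u
  proof (cases "u = 0")
    case False
    then have u: "0 < u" "u \<le> 1" using that by auto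
    \<comment> \<open>With this common factor pulled out, every term below is \<open>w\<close> times
      a polynomial in s, t and u with coefficients built from cos \<theta>, sin \<theta> and
      \<kappa>.\<close>
    define w where "w = u powr (\<alpha> - 1) / (s\<^sup>2 + u\<^sup>2)"
    have w: "w > 0" using u s2 by (simp add: w_def)
    have uw: "u powr \<alpha> = u * w * (s\<^sup>2 + u\<^sup>2)" "u powr (\<alpha> - 1) = w * (s\<^sup>2 + u\<^sup>2)"
      using u s2(2)[of u] by (simp_all add: w_def powr_mult_base[symmetric] powr_diff)
    have er: "e r u = w * u * (r * cos \<theta> + u * sin \<theta>)" if "r\<^sup>2 = s\<^sup>2" for r
      using s2(2)[of u] that by (simp add: e_def uw)
    have "(s\<^sup>2 + 1) * e s u - cos \<theta> * s * u powr \<alpha>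
        = w * (cos \<theta> * u * (1 - u\<^sup>2) * s + sin \<theta> * u\<^sup>2 * (1 + s\<^sup>2))"
      by (simp add: er uw algebra_simps power2_eq_square)
    also have "norm \<dots> \<le> w * (cos \<theta> * u * (1 - u\<^sup>2) * t + sin \<theta> * u\<^sup>2 * (1 + s\<^sup>2))"
    proof -
      have "u\<^sup>2 \<le> 1" using u by (simp add: power_le_one)
      then have "\<bar>cos \<theta> * u * (1 - u\<^sup>2) * s\<bar> = cos \<theta> * u * (1 - u\<^sup>2) * t"
        using cs u by (simp add: abs_mult t_def)
      moreover have "\<bar>sin \<theta> * u\<^sup>2 * (1 + s\<^sup>2)\<bar> = sin \<theta> * u\<^sup>2 * (1 + s\<^sup>2)"
        using cs by (simp add: abs_mult)
      ultimately have "\<bar>cos \<theta> * u * (1 - u\<^sup>2) * s + sin \<theta> * u\<^sup>2 * (1 + s\<^sup>2)\<bar>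
          \<le> cos \<theta> * u * (1 - u\<^sup>2) * t + sin \<theta> * u\<^sup>2 * (1 + s\<^sup>2)"
        by linarith
      then show ?thesis using w by (simp only: real_norm_def abs_mult abs_of_pos mult_le_cancel_left_pos)
    qed
    \<comment> \<open>The added nonnegative term cancels everything of degree above two in t and u,
      leaving exactly the convex combination.\<close>
    also have "\<dots> \<le> w * (cos \<theta> * u * (1 - u\<^sup>2) * t + sin \<theta> * u\<^sup>2 * (1 + s\<^sup>2)) +
       w * (t * ((1 - u\<^sup>2 - \<kappa>) * (t * sin \<theta> - u * cos \<theta>)))"
    proof -
      have "0 \<le> (1 - u\<^sup>2 - \<kappa>) * (t * sin \<theta> - u * cos \<theta>)"
      proof (cases "u \<le> t * tan \<theta>")
        case True
        then have "u\<^sup>2 \<le> (t * tan \<theta>)\<^sup>2" using u by (intro power_mono) auto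
        moreover have "u\<^sup>2 \<le> 1" using u by (simp add: power_le_one)
        moreover have "u * cos \<theta> \<le> t * sin \<theta>" using True cs by (simp add: tan_def field_simps)
        ultimately show ?thesis unfolding \<kappa>_def by (intro mult_nonneg_nonneg) auto
      next
        case False
        then have "(t * tan \<theta>)\<^sup>2 \<le> u\<^sup>2" using t cs by (intro power_mono) (auto simp: tan_def)
        moreover have "t * sin \<theta> \<le> u * cos \<theta>" using False cs by (simp add: tan_def field_simps)
        ultimately show ?thesis unfolding \<kappa>_def by (intro mult_nonpos_nonpos) auto
      qed
      then show ?thesis using w t by simp
    qed
    also have "\<dots> = (1 - \<kappa>) * sin \<theta> * u powr (\<alpha> - 1) + \<kappa> * e t u"
      unfolding er[OF t(2)] uw t(2)[symmetric] by (simp add: algebra_simps power2_eq_square)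
    finally show ?thesis .
  \<comment> \<open>At u = 0 both sides vanish, since \<open>0 powr a = 0\<close> also for the
    negative exponent \<alpha> - 1.\<close>
  qed (simp add: e_def)
  then have "norm ((s\<^sup>2 + 1) * integral {0..1} (e s) - cos \<theta> * s * (1 / (\<alpha> + 1)))
     \<le> (1 - \<kappa>) * sin \<theta> * (1 / \<alpha>) + \<kappa> * integral {0..1} (e t)"
    using has_integral_norm_bound_integral_component[where k = 1, OF L R] by simp
  also have "\<dots> \<le> (1 - \<kappa>) * sin \<theta> * (1 / \<alpha>) + \<kappa> * (sin \<theta> / \<alpha>)"
    using integral_vertical_kernel_le[OF t(1) a] k by (intro add_left_mono mult_left_mono) (auto simp: e_def \<theta>_def)
  also have "\<dots> = sin \<theta> / \<alpha>" using a by (simp add: field_simps)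
  finally have "\<bar>(s\<^sup>2 + 1) * integral {0..1} (e s) - cos \<theta> * s * (1 / (\<alpha> + 1))\<bar> / (s\<^sup>2 + 1) \<le> sin \<theta> / \<alpha> / (s\<^sup>2 + 1)"
    using s2 by (intro divide_right_mono) auto
  also have "\<bar>(s\<^sup>2 + 1) * integral {0..1} (e s) - cos \<theta> * s * (1 / (\<alpha> + 1))\<bar> / (s\<^sup>2 + 1)
     = \<bar>((s\<^sup>2 + 1) * integral {0..1} (e s) - cos \<theta> * s * (1 / (\<alpha> + 1))) / (s\<^sup>2 + 1)\<bar>"
    using s2 by (simp add: abs_divide)
  also have "((s\<^sup>2 + 1) * integral {0..1} (e s) - cos \<theta> * s * (1 / (\<alpha> + 1))) / (s\<^sup>2 + 1)
     = integral {0..1} (e s) - cos \<theta> / (\<alpha> + 1) * (s / (s\<^sup>2 + 1))"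
    using s2(1) by (simp add: diff_divide_distrib)
  finally show ?thesis by (simp add: e_def)
qed

section \<open>Contour integrals along vertical segments\<close>

lemma contour_integral_vertical:
  "contour_integral (linepath (of_real l) (Complex l b)) h =
    \<i> * of_real b * integral {0..1} (\<lambda>u. h (Complex l (b * u)))"
proof -
  have "linepath (of_real l) (Complex l b) u = Complex l (b * u)" for u
    by (simp add: linepath_def complex_eq_iff algebra_simps)
  moreover have "Complex l b - of_real l = \<i> * of_real b"
    by (simp add: complex_eq_iff)
  ultimately show ?thesis
    by (simp add: contour_integral_integral mult.commute)
qed

text \<open>Split at the real midpoint. Conjugation turns the integral over the lower half into that
  over the upper half with \<open>cnj G\<close> in place of \<open>G\<close>, and G + cnj G = 2 Re
  G.\<close>

lemma contour_integral_vertical_symmetric: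
  assumes h: "continuous_on (closed_segment (Complex l (-b)) (Complex l b)) h"
    and cnj_h: "\<And>z. Re z = l \<Longrightarrow> h (cnj z) = cnj (h z)"
  shows "contour_integral (linepath (Complex l (-b)) (Complex l b)) h =
    \<i> * of_real (2 * b * Re (integral {0..1} (\<lambda>u. h (Complex l (b * u)))))"
proof -
  define G where "G = integral {0..1} (\<lambda>u. h (Complex l (b * u)))"
  have "of_real l = midpoint (Complex l (-b)) (Complex l b)"
    by (simp add: midpoint_def complex_eq_iff)
  then have mid: "of_real l \<in> closed_segment (Complex l (-b)) (Complex l b)"
    by simp
  have low: "contour_integral (linepath (of_real l) (Complex l (-b))) h = - (\<i> * of_real b * cnj G)"
  proof -
    have "h (Complex l (- b * u)) = cnj (h (Complex l (b * u)))" for u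
      using cnj_h[of "Complex l (b * u)"] by (simp add: complex_cnj)
    then show ?thesis unfolding contour_integral_vertical G_def
      by (simp add: Henstock_Kurzweil_Integration.integral_cnj)
  qed
  have "contour_integral (linepath (Complex l (-b)) (Complex l b)) h =
    contour_integral (linepath (Complex l (-b)) (of_real l)) h + contour_integral (linepath (of_real l) (Complex l b)) h"
    using h mid by (rule contour_integral_split_linepath)
  also have "contour_integral (linepath (Complex l (-b)) (of_real l)) h = - contour_integral (linepath (of_real l) (Complex l (-b))) h"
    by (rule contour_integral_reverse_linepath)
      (rule continuous_on_subset[OF h], use mid in \<open>simp add: subset_closed_segment\<close>)
  finally have "contour_integral (linepath (Complex l (-b)) (Complex l b)) h = \<i> * of_real b * (cnj G + G)"
    unfolding low unfolding contour_integral_vertical G_def[symmetric] by (simp add: algebra_simps)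
  then show ?thesis
    unfolding G_def[symmetric] by (simp add: complex_eq_iff)
qed

section \<open>The Riesz kernel (1 - z/l)^\<alpha>\<close>

lemma continuous_on_riesz_kernel:
  assumes "l > 0" "\<alpha> > 0"
  shows "continuous_on {z. Re z \<le> l} (\<lambda>z. (1 - z / of_real l) powr of_real \<alpha>)"
  using assms by (intro continuous_intros) (auto simp: Re_divide_of_real)

text \<open>The base meets the cut of the power exactly on [l, \<infinity>). This large domain is
  needed to move \<Gamma>, which may leave the half-plane Re z \<le> l.\<close>

lemma holomorphic_on_riesz_kernel:
  assumes "l > 0"
  shows "(\<lambda>z. (1 - z / of_real l) powr of_real \<alpha>) holomorphic_on - of_real ` {l..}"
proof (intro holomorphic_intros)
  fix z assume z: "z \<in> - complex_of_real ` {l..}"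
  show "1 - z / of_real l \<notin> \<real>\<^sub>\<le>\<^sub>0"
  proof
    assume "1 - z / of_real l \<in> \<real>\<^sub>\<le>\<^sub>0"
    then have "Re z \<ge> l" "z = of_real (Re z)"
      using assms by (auto simp: complex_nonpos_Reals_iff Re_divide_of_real Im_divide_of_real complex_eq_iff)
    then show False using z by (metis ComplD atLeast_iff imageI)
  qed
qed (use assms in auto)

text \<open>Powers commute with conjugation except on the negative real axis, and here the base has
  nonnegative real part.\<close>

lemma riesz_kernel_cnj:
  assumes "l > 0" "Re z \<le> l"
  shows "(1 - cnj z / of_real l) powr of_real \<alpha> = cnj ((1 - z / of_real l) powr of_real \<alpha>)"
  using assms by (subst cnj_powr) (auto simp: Re_divide_of_real)

text \<open>On the upper half of the line the base is -i y/l, so the phase of the kernel is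
  constant.\<close>

lemma riesz_kernel_vertical:
  assumes "l > 0" "y \<ge> 0"
  shows "(1 - Complex l y / of_real l) powr of_real \<alpha> = of_real ((y / l) powr \<alpha>) * cis (- (pi * \<alpha> / 2))"
proof -
  have "1 - Complex l y / of_real l = of_real (y / l) * cis (- (pi / 2))"
    using assms by (simp add: complex_eq_iff Re_divide_of_real Im_divide_of_real)
  moreover have "- (pi / 2) \<le> pi" using pi_gt_zero by linarith
  ultimately show ?thesis
    using powr_rcis[of "y / l" "- (pi / 2)" \<alpha>] assms by (simp add: mult.commute)
qed

text \<open>Cauchy-Schwarz against the vector (1, pi/2), with the defect written out by Lagrange's
  identity.\<close>

lemma abs_add_half_pi_abs_le:
  "\<bar>Re w\<bar> + pi / 2 * \<bar>Im w\<bar> \<le> sqrt (1 + pi\<^sup>2 / 4) * cmod w"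
proof (rule power2_le_imp_le)
  have "(\<bar>Re w\<bar> + pi / 2 * \<bar>Im w\<bar>)\<^sup>2 + (pi / 2 * \<bar>Re w\<bar> - \<bar>Im w\<bar>)\<^sup>2 = (1 + pi\<^sup>2 / 4) * (cmod w)\<^sup>2"
    unfolding cmod_power2 by (simp add: power2_eq_square algebra_simps)
  also have "\<dots> = (sqrt (1 + pi\<^sup>2 / 4) * cmod w)\<^sup>2"
    by (simp add: power_mult_distrib add_nonneg_nonneg)
  finally show "(\<bar>Re w\<bar> + pi / 2 * \<bar>Im w\<bar>)\<^sup>2 \<le> (sqrt (1 + pi\<^sup>2 / 4) * cmod w)\<^sup>2"
    using zero_le_power2[of "pi / 2 * \<bar>Re w\<bar> - \<bar>Im w\<bar>"] by linarith
qed (simp add: add_nonneg_nonneg)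

section \<open>Stieltjes transforms of measures vanishing near zero and near \<open>l\<close>\<close>

text \<open>What the contour argument needs of dN: \<open>c\<close> keeps the mass away from the
  vertex 0 of the triangle used below, and \<open>d\<close> keeps it away from the vertical line Re
  z = l.\<close>

locale stieltjes_support = sigma_finite_measure M for M :: "real measure" +
  fixes c d l :: real
  assumes sets_eq [measurable_cong, simp]: "sets M = sets borel"
    and c_pos: "c > 0" and d_pos: "d > 0"
    and AE_support: "AE x in M. c \<le> x \<and> d \<le> \<bar>x - l\<bar>"
    and integrable_inverse: "integrable M inverse"
begin

text \<open>An explicit closed set carrying \<open>M\<close> stands in for the topological support;
  closedness gives positive distance to compact sets.\<close>

definition K :: "real set" where "K = {x. c \<le> x \<and> d \<le> \<bar>x - l\<bar>}"

definition S :: "complex \<Rightarrow> complex" where "S z = (LINT x|M. inverse (of_real x - z))"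

lemma AE_K: "AE x in M. x \<in> K"
  using AE_support by (simp add: K_def)

lemma K_pos: "x \<in> K \<Longrightarrow> x > 0"
  using c_pos by (auto simp: K_def)

lemma closed_K: "closed K"
proof -
  have "K = {x. c \<le> x} \<inter> {x. d \<le> \<bar>x - l\<bar>}" by (auto simp: K_def)
  then show ?thesis by (auto intro!: closed_Int closed_Collect_le continuous_intros)
qed

lemma K_borel [measurable]: "K \<in> sets borel"
  using closed_K by simp

lemma space_UNIV [simp]: "space M = UNIV"
  using sets_eq_imp_space_eq[OF sets_eq] by simp

lemma closed_of_real_K: "closed (complex_of_real ` K)"
  using closed_K by (intro closed_injective_linear_image) (auto intro: injI linearI simp: scaleR_conv_of_real)

text \<open>If \<open>A\<close> lies in the disc of radius R, then |x - w| \<ge> x/2 for x \<ge> 2R;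
  for smaller x the distance r from \<open>A\<close> to \<open>K\<close> is at least (r/2R) x.
  Growth linear in x is what domination by 1/x requires.\<close>

lemma norm_bound:
  assumes A: "compact A" "A \<inter> of_real ` K = {}"
  obtains e where "e > 0" "\<And>x w. x \<in> K \<Longrightarrow> w \<in> A \<Longrightarrow> e * x \<le> cmod (of_real x - w)"
proof -
  from separate_compact_closed[OF A(1) closed_of_real_K A(2)]
  obtain r where "r > 0" "\<forall>w\<in>A. \<forall>y\<in>complex_of_real ` K. r \<le> dist w y" by auto
  then have r: "r > 0" "\<And>w x. w \<in> A \<Longrightarrow> x \<in> K \<Longrightarrow> r \<le> dist w (of_real x)"
    by auto
  obtain R where R: "R > 0" "\<And>w. w \<in> A \<Longrightarrow> cmod w \<le> R"
    using compact_imp_bounded[OF A(1)] bounded_pos by blast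
  show ?thesis
  proof (rule that[of "min (1/2) (r / (2 * R))"])
    fix x w assume x: "x \<in> K" and w: "w \<in> A"
    have x0: "x > 0" using K_pos x .
    show "min (1/2) (r / (2 * R)) * x \<le> cmod (of_real x - w)"
    proof (cases "x \<ge> 2 * R")
      case True
      have "min (1/2) (r / (2 * R)) * x \<le> 1/2 * x" using x0 by (intro mult_right_mono) auto
      also have "\<dots> \<le> x - R" using True by simp
      also have "\<dots> \<le> cmod (of_real x) - cmod w" using R(2)[OF w] x0 by simp
      also have "\<dots> \<le> cmod (of_real x - w)" by (rule norm_triangle_ineq2)
      finally show ?thesis .
    next
      case False
      have "min (1/2) (r / (2 * R)) * x \<le> r / (2 * R) * (2 * R)"
        using x0 False r R by (intro mult_mono) auto
      also have "\<dots> = r" using R by simp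
      also have "\<dots> \<le> cmod (of_real x - w)" using r(2)[OF w x] by (simp add: dist_norm norm_minus_commute)
      finally show ?thesis .
    qed
  qed (use r R in auto)
qed

section \<open>Domination by 1/x and holomorphy of S\<close>

lemma integrable_dominated:
  fixes f :: "real \<Rightarrow> 'b::{banach, second_countable_topology}"
  assumes "f \<in> borel_measurable borel" "\<And>x. x \<in> K \<Longrightarrow> norm (f x) \<le> B * inverse x"
  shows "integrable M f" "norm (LINT x|M. f x) \<le> B * (LINT x|M. inverse x)"
proof -
  have ae: "AE x in M. norm (f x) \<le> B * inverse x"
    using AE_K by eventually_elim (rule assms(2))
  have f [measurable]: "f \<in> borel_measurable M" using assms(1) by simp
  have iB: "integrable M (\<lambda>x. B * inverse x)" using integrable_inverse by simp
  have "AE x in M. norm (f x) \<le> norm (B * inverse x)"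
    using ae by eventually_elim (metis abs_ge_self order_trans real_norm_def)
  then show i: "integrable M f" by (rule Bochner_Integration.integrable_bound[OF iB f])
  have "norm (LINT x|M. f x) \<le> (LINT x|M. norm (f x))" by (rule integral_norm_bound)
  also have "\<dots> \<le> (LINT x|M. B * inverse x)"
    using iB i ae by (intro integral_mono_AE) auto
  finally show "norm (LINT x|M. f x) \<le> B * (LINT x|M. inverse x)" by simp
qed

lemma integrable_inverse_powers:
  assumes "z \<notin> of_real ` K"
  shows "integrable M (\<lambda>x. inverse (of_real x - z))" "integrable M (\<lambda>x. (inverse (of_real x - z))\<^sup>2)"
    "integrable M (\<lambda>x. (cmod (inverse (of_real x - z)))\<^sup>2)"
proof -
  obtain e where e: "e > 0" "\<And>x. x \<in> K \<Longrightarrow> e * x \<le> cmod (of_real x - z)"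
    using norm_bound[of "{z}" thesis] assms by simp
  have 1: "cmod (inverse (of_real x - z)) \<le> inverse e * inverse x" if "x \<in> K" for x
  proof -
    have "inverse (cmod (of_real x - z)) \<le> inverse (e * x)"
      using e that K_pos[OF that] by (intro le_imp_inverse_le) auto
    then show ?thesis by (simp add: norm_inverse inverse_mult_distrib)
  qed
  \<comment> \<open>Of the two factors 1/x one is kept for integrability and the other is bounded by
    1/c.\<close>
  have 2: "(cmod (inverse (of_real x - z)))\<^sup>2 \<le> (inverse e)\<^sup>2 * inverse c * inverse x" if "x \<in> K" for x
  proof -
    have "(cmod (inverse (of_real x - z)))\<^sup>2 \<le> (inverse e * inverse x)\<^sup>2"
      using 1[OF that] by (intro power_mono) auto
    also have "\<dots> = (inverse e)\<^sup>2 * inverse x * inverse x" by (simp add: power2_eq_square)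
    also have "\<dots> \<le> (inverse e)\<^sup>2 * inverse c * inverse x"
      using that c_pos K_pos[OF that] by (intro mult_right_mono mult_left_mono le_imp_inverse_le) (auto simp: K_def)
    finally show ?thesis .
  qed
  show "integrable M (\<lambda>x. inverse (of_real x - z))"
    by (rule integrable_dominated(1)[OF _ 1]) auto
  show "integrable M (\<lambda>x. (inverse (of_real x - z))\<^sup>2)"
    by (rule integrable_dominated(1)) (use 2 in \<open>auto simp: norm_power\<close>)
  show "integrable M (\<lambda>x. (cmod (inverse (of_real x - z)))\<^sup>2)"
    by (rule integrable_dominated(1)) (use 2 in \<open>auto simp: norm_power\<close>)
qed

text \<open>Differentiation under the integral with an explicit remainder: for a = x - z the
  difference quotient minus a^(-2) equals h/(a^2 (a - h)), which on \<open>K\<close> is at most |h|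
  times a fixed multiple of 1/x.\<close>

lemma S_has_field_derivative:
  assumes z: "z \<notin> of_real ` K"
  shows "(S has_field_derivative (LINT x|M. (inverse (of_real x - z))\<^sup>2)) (at z)"
proof -
  have "open (- of_real ` K :: complex set)" using closed_of_real_K by auto
  then obtain r where r: "r > 0" "cball z r \<subseteq> - of_real ` K"
    using z open_contains_cball by (metis ComplI)
  obtain e where e: "e > 0" "\<And>x w. x \<in> K \<Longrightarrow> w \<in> cball z r \<Longrightarrow> e * x \<le> cmod (of_real x - w)"
    using norm_bound[of "cball z r"] r by auto
  define D where "D = (LINT x|M. (inverse (of_real x - z))\<^sup>2)"
  \<comment> \<open>The remainder has three factors of size at most 1/(e x); two of the 1/x are
    bounded by 1/c.\<close>
  define C where "C = inverse (e ^ 3 * c\<^sup>2) * (LINT x|M. inverse x)"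
  have "norm ((S (z + h) - S z) / h - D) \<le> cmod h * C" if h: "h \<noteq> 0" "cmod h < r" for h
  proof -
    define g where "g = (\<lambda>x. (inverse (of_real x - (z + h)) - inverse (of_real x - z)) / h - (inverse (of_real x - z))\<^sup>2)"
    have zh: "z + h \<notin> of_real ` K" "z + h \<in> cball z r" using r(2) h subsetD[OF r(2), of "z + h"] by (auto simp: dist_norm)
    have eq: "(S (z + h) - S z) / h - D = (LINT x|M. g x)"
      unfolding S_def D_def g_def using integrable_inverse_powers[OF z] integrable_inverse_powers[OF zh(1)] by simp
    have "norm (g x) \<le> (cmod h * inverse (e ^ 3 * c\<^sup>2)) * inverse x" if x: "x \<in> K" for x
    proof -
      have x0: "x > 0" "c \<le> x" using K_pos x by (auto simp: K_def)
      define a where "a = of_real x - z"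
      have n: "e * x \<le> cmod a" "e * x \<le> cmod (a - h)"
        using e(2)[OF x, of z] e(2)[OF x zh(2)] r(1) by (auto simp: a_def algebra_simps)
      then have nz: "a \<noteq> 0" "a - h \<noteq> 0" using mult_pos_pos[OF e(1) x0(1)] by auto
      have "g x = (inverse (a - h) - inverse a) / h - (inverse a)\<^sup>2"
        by (simp add: g_def a_def algebra_simps)
      also have "\<dots> = h * inverse (a\<^sup>2 * (a - h))"
        using nz h by (simp add: field_simps power2_eq_square)
      finally have "norm (g x) = cmod h * inverse ((cmod a)\<^sup>2 * cmod (a - h))"
        by (simp add: norm_mult norm_inverse norm_power)
      also have "\<dots> \<le> cmod h * inverse ((e * x)\<^sup>2 * (e * x))"
        using n e(1) x0 by (intro mult_left_mono le_imp_inverse_le mult_mono power_mono) auto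
      also have "\<dots> = cmod h * inverse (e ^ 3 * x\<^sup>2 * x)"
        by (simp add: power2_eq_square power3_eq_cube mult_ac)
      also have "\<dots> \<le> cmod h * inverse (e ^ 3 * c\<^sup>2 * x)"
        using e(1) x0 c_pos by (intro mult_left_mono le_imp_inverse_le mult_right_mono power_mono) auto
      finally show ?thesis by (simp add: mult_ac)
    qed
    then have "norm (LINT x|M. g x) \<le> (cmod h * inverse (e ^ 3 * c\<^sup>2)) * (LINT x|M. inverse x)"
      by (intro integrable_dominated(2)) (auto simp: g_def)
    then show ?thesis unfolding eq C_def by (simp add: mult_ac)
  qed
  then have "\<forall>\<^sub>F h in at 0. norm ((S (z + h) - S z) / h - D) \<le> cmod h * C"
    using r(1) by (auto simp: eventually_at intro!: exI[of _ r])
  moreover have "((\<lambda>h. cmod h * C) \<longlongrightarrow> 0) (at 0)"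
    by (auto intro!: tendsto_eq_intros)
  ultimately have "((\<lambda>h. (S (z + h) - S z) / h - D) \<longlongrightarrow> 0) (at 0)"
    by (rule Lim_null_comparison)
  then show ?thesis unfolding D_def[symmetric] DERIV_def by (rule LIM_zero_cancel)
qed

lemma S_holomorphic: "S holomorphic_on (- of_real ` K)"
  unfolding holomorphic_on_def field_differentiable_def
  using S_has_field_derivative has_field_derivative_at_within by blast

section \<open>Symmetry of S and its growth along vertical lines\<close>

lemma S_cnj: "S (cnj z) = cnj (S z)"
proof -
  have "cnj (S z) = (LINT x|M. cnj (inverse (of_real x - z)))"
    unfolding S_def by (rule Bochner_Integration.integral_cnj[symmetric])
  then show ?thesis by (simp add: S_def del: Bochner_Integration.integral_cnj)
qed

text \<open>Pointwise, Im (1/(x - z)) = Im z / |x - z|^2. This lets |S z| control the integral of |x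
  - z|^(-2).\<close>

lemma Im_S:
  assumes "Im z \<noteq> 0"
  shows "Im (S z) = Im z * (LINT x|M. (cmod (inverse (of_real x - z)))\<^sup>2)"
proof -
  have z: "z \<notin> of_real ` K" using assms by auto
  have "Im (inverse (of_real x - z)) = Im z * (cmod (inverse (of_real x - z)))\<^sup>2" for x
    by (simp add: norm_inverse power_inverse cmod_power2 divide_inverse)
  then show ?thesis
    unfolding S_def using integrable_inverse_powers[OF z] by (simp flip: integral_Im)
qed

text \<open>
  Integrating \<open>|u||v| \<le> (a/b |u|\<^sup>2 + b/a |v|\<^sup>2)/2\<close> and using \<open>Im S(y + i\<eta>) = \<eta> \<integral> |x - y - i\<eta>|\<^sup>-\<^sup>2\<close> bounds
  \<open>|S za - S zb|\<close> by \<open>(b - a)/2 (|S za|/b + |S zb|/a)\<close>, which rearranges to the claim.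
\<close>

lemma S_vertical_mono:
  assumes ab: "0 < a" "a \<le> b" and za: "za = Complex y a" and zb: "zb = Complex y b"
  shows "a * cmod (S za) \<le> b * cmod (S zb)"
proof -
  define n where "n = (\<lambda>z x. cmod (inverse (complex_of_real x - z)))"
  have z: "za \<notin> of_real ` K" "zb \<notin> of_real ` K" "Im za \<noteq> 0" "Im zb \<noteq> 0"
    using ab za zb by (auto simp: complex_eq_iff)
  have b: "b > 0" using ab by simp
  have ii: "integrable M (\<lambda>x. (n za x)\<^sup>2)" "integrable M (\<lambda>x. (n zb x)\<^sup>2)"
    using integrable_inverse_powers(3)[OF z(1)] integrable_inverse_powers(3)[OF z(2)] by (auto simp: n_def)
  have q: "a * (LINT x|M. (n za x)\<^sup>2) \<le> cmod (S za)" "b * (LINT x|M. (n zb x)\<^sup>2) \<le> cmod (S zb)"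
    using Im_S[OF z(3)] Im_S[OF z(4)] abs_Im_le_cmod[of "S za"] abs_Im_le_cmod[of "S zb"] za zb by (auto simp: n_def)
  have pt: "norm (inverse (of_real x - za) - inverse (of_real x - zb)) \<le> (b - a) / 2 * (a / b * (n za x)\<^sup>2 + b / a * (n zb x)\<^sup>2)" for x
  proof -
    have nz: "of_real x - za \<noteq> 0" "of_real x - zb \<noteq> 0" using z by (auto simp: complex_eq_iff)
    have "inverse (of_real x - za) - inverse (of_real x - zb) = (za - zb) * (inverse (of_real x - za) * inverse (of_real x - zb))"
      using nz by (simp add: field_simps)
    moreover have "cmod (za - zb) = b - a" using ab za zb by (simp add: cmod_def)
    ultimately have "norm (inverse (of_real x - za) - inverse (of_real x - zb)) = (b - a) * (n za x * n zb x)"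
      by (simp add: norm_mult n_def)
    also have "n za x * n zb x \<le> 1/2 * (a / b * (n za x)\<^sup>2 + b / a * (n zb x)\<^sup>2)"
    proof -
      have "0 \<le> (a * n za x - b * n zb x)\<^sup>2 / (2 * a * b)" using ab by simp
      also have "\<dots> = 1/2 * (a / b * (n za x)\<^sup>2 + b / a * (n zb x)\<^sup>2) - n za x * n zb x"
        using ab by (simp add: field_simps power2_eq_square)
      finally show ?thesis by simp
    qed
    finally show ?thesis using ab by (simp add: mult_left_mono)
  qed
  have "cmod (S za - S zb) = norm (LINT x|M. inverse (of_real x - za) - inverse (of_real x - zb))"
    unfolding S_def using integrable_inverse_powers(1)[OF z(1)] integrable_inverse_powers(1)[OF z(2)] by simp
  also have "\<dots> \<le> (LINT x|M. (b - a) / 2 * (a / b * (n za x)\<^sup>2 + b / a * (n zb x)\<^sup>2))"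
    using integrable_inverse_powers(1)[OF z(1)] integrable_inverse_powers(1)[OF z(2)] ii pt
    by (intro Bochner_Integration.integral_norm_bound_integral) auto
  also have "\<dots> = (b - a) / 2 * (a * (LINT x|M. (n za x)\<^sup>2) / b + b * (LINT x|M. (n zb x)\<^sup>2) / a)"
    using ii by simp
  also have "\<dots> \<le> (b - a) / 2 * (cmod (S za) / b + cmod (S zb) / a)"
    using q ab b by (intro mult_left_mono add_mono divide_right_mono) auto
  finally have "cmod (S za) - cmod (S zb) \<le> (b - a) / 2 * (cmod (S za) / b + cmod (S zb) / a)"
    using norm_triangle_ineq2 order_trans by blast
  then have "(cmod (S za) - cmod (S zb)) * (2 * a * b) \<le> (b - a) / 2 * (cmod (S za) / b + cmod (S zb) / a) * (2 * a * b)"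
    using ab b by (intro mult_right_mono) auto
  also have "\<dots> = (b - a) * (a * cmod (S za) + b * cmod (S zb))"
    using ab b by (simp add: field_simps)
  \<comment> \<open>After multiplication by 2ab the difference of the two sides factors, with the
    positive factor a + b.\<close>
  finally have "0 \<le> (a + b) * (b * cmod (S zb) - a * cmod (S za))"
    by (simp add: algebra_simps)
  then show ?thesis using ab by (simp add: zero_le_mult_iff)
qed

text \<open>The indicator makes the integrand measurable: off \<open>K\<close> the inner integrand may have poles.\<close>

lemma contour_integral_S:
  assumes seg: "closed_segment a b \<inter> of_real ` K = {}" and f: "continuous_on (closed_segment a b) f"
  defines "I \<equiv> (\<lambda>x. indicator K x *\<^sub>R contour_integral (linepath a b) (\<lambda>z. inverse (of_real x - z) * f z))"
  shows "integrable M I" and "contour_integral (linepath a b) (\<lambda>z. S z * f z) = (LINT x|M. I x)"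
proof -
  interpret P: pair_sigma_finite M lborel ..
  define p where "p = linepath a b"
  have p: "continuous_on A p" "p ` {0..1} = closed_segment a b" for A
    by (simp_all add: p_def linepath_image_01 continuous_on_linepath)
  have pm [measurable]: "p \<in> borel_measurable borel" using p(1) by (rule borel_measurable_continuous_onI)
  have fp: "continuous_on {0..1} (\<lambda>u. f (p u))"
    by (rule continuous_on_compose2[OF f p(1)]) (simp add: p(2))
  \<comment> \<open>Continuity of \<open>f\<close> is known on the segment only; cutting off outside
    [0,1] gives a function that is Borel on the whole line.\<close>
  define F where "F = (\<lambda>u. indicator {0..1::real} u *\<^sub>R f (p u))"
  have Fm [measurable]: "F \<in> borel_measurable borel" unfolding F_def
    using fp by (intro borel_measurable_continuous_on_indicator) auto
  define G where "G = (\<lambda>x u. indicator K x *\<^sub>R (inverse (of_real x - p u) * F u * (b - a)))"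
  have Gm [measurable]: "case_prod G \<in> borel_measurable (M \<Otimes>\<^sub>M lborel)"
    unfolding G_def by measurable
  obtain e where e: "e > 0" "\<And>x w. x \<in> K \<Longrightarrow> w \<in> closed_segment a b \<Longrightarrow> e * x \<le> cmod (of_real x - w)"
    using norm_bound[of "closed_segment a b"] seg by auto
  have "bounded ((\<lambda>u. f (p u)) ` {0..1})"
    by (intro compact_imp_bounded compact_continuous_image fp compact_Icc)
  then obtain B where "B > 0" "\<forall>z\<in>(\<lambda>u. f (p u)) ` {0..1}. cmod z \<le> B"
    unfolding bounded_pos by auto
  then have B: "B > 0" "\<And>u. u \<in> {0..1} \<Longrightarrow> cmod (f (p u)) \<le> B"
    by auto
  define C where "C = inverse e * B * cmod (b - a)"
  have C0: "C \<ge> 0" using e B by (simp add: C_def)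
  have Gb: "norm (G x u) \<le> indicator {0..1} u * (C * inverse x)" if "x \<in> K" for x u
  proof (cases "u \<in> {0..1}")
    case True
    then have "p u \<in> closed_segment a b" using p(2) by blast
    then have "inverse (cmod (of_real x - p u)) \<le> inverse (e * x)"
      using e(1) e(2)[OF that, of "p u"] K_pos[OF that] True p(2) by (intro le_imp_inverse_le) auto
    then have "norm (G x u) \<le> inverse (e * x) * B * cmod (b - a)"
      using that True B e K_pos[OF that] unfolding G_def F_def
      by (auto simp: norm_mult norm_inverse intro!: mult_mono)
    then show ?thesis using True by (simp add: C_def mult_ac)
  qed (simp add: G_def F_def)
  have i1: "integrable lborel (G x)" for x
  proof (cases "x \<in> K")
    case True
    have "integrable lborel (\<lambda>u. indicator {0..1::real} u *\<^sub>R (C * inverse x))"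
      by (intro integrable_scaleR_left) (simp add: integrable_indicator_iff)
    then show ?thesis
    proof (rule Bochner_Integration.integrable_bound)
      show "G x \<in> borel_measurable lborel" unfolding G_def by measurable
    next
      have "0 \<le> indicator {0..1} u * (C * inverse x)" for u :: real
        using C0 K_pos[OF True] by simp
      then show "AE u in lborel. norm (G x u) \<le> norm (indicator {0..1::real} u *\<^sub>R (C * inverse x))"
        using Gb[OF True] by simp
    qed
  qed (simp add: G_def)
  \<comment> \<open>The hypothesis of Fubini: on \<open>K\<close> the inner integral of the norm is
    at most C/x, by the bound uniform in u.\<close>
  have nG: "integrable M (\<lambda>x. LINT u|lborel. norm (G x u))"
  proof (rule integrable_dominated(1))
    show "(\<lambda>x. LINT u|lborel. norm (G x u)) \<in> borel_measurable borel"
      unfolding G_def by measurable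
    fix x assume x: "x \<in> K"
    have "norm (LINT u|lborel. norm (G x u)) = (LINT u|lborel. norm (G x u))"
      by (simp add: integral_nonneg)
    also have "\<dots> \<le> (LINT u|lborel. indicator {0..1::real} u * (C * inverse x))"
      using i1 Gb[OF x] by (intro integral_mono) (auto simp: integrable_indicator_iff)
    also have "\<dots> = C * inverse x" by simp
    finally show "norm (LINT u|lborel. norm (G x u)) \<le> C * inverse x" .
  qed
  have iG: "integrable (M \<Otimes>\<^sub>M lborel) (case_prod G)"
    by (rule P.Fubini_integrable) (use nG i1 in auto)
  \<comment> \<open>Contour integrals are gauge integrals and Fubini is about Lebesgue integrals;
    the two agree because the integrand is continuous on [0,1].\<close>
  have intx: "(LINT u|lborel. G x u) = I x" for x
  proof (cases "x \<in> K")
    case xK: True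
    have "of_real x - p u \<noteq> 0" if "u \<in> {0..1}" for u
      using p(2) seg xK that by (metis IntI empty_iff image_eqI right_minus_eq)
    then have cp: "continuous_on {0..1} (\<lambda>u. inverse (of_real x - p u) * f (p u) * (b - a))"
      by (intro continuous_intros fp p(1)) auto
    have "(LINT u|lborel. G x u) = (LINT u:{0..1}|lborel. inverse (of_real x - p u) * f (p u) * (b - a))"
      unfolding set_lebesgue_integral_def using xK
      by (intro Bochner_Integration.integral_cong) (simp_all add: G_def F_def)
    also have "\<dots> = integral {0..1} (\<lambda>u. inverse (of_real x - p u) * f (p u) * (b - a))"
      by (rule set_borel_integral_eq_integral(2)) (rule borel_integrable_atLeastAtMost'[OF cp])
    also have "\<dots> = I x"
      using xK by (simp add: p_def I_def contour_integral_integral)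
    finally show ?thesis .
  qed (simp add: G_def I_def)
  show "integrable M I" using P.integrable_fst'[OF iG] by (simp add: intx)
  have intu: "(LINT x|M. G x u) = indicator {0..1} u *\<^sub>R (S (p u) * f (p u) * (b - a))" for u
  proof -
    have "AE x in M. G x u = inverse (of_real x - p u) * (F u * (b - a))"
      using AE_K by eventually_elim (simp add: G_def)
    then have "(LINT x|M. G x u) = (LINT x|M. inverse (of_real x - p u) * (F u * (b - a)))"
      by (intro integral_cong_AE) (simp_all add: G_def)
    also have "\<dots> = S (p u) * (F u * (b - a))"
      unfolding S_def by (rule integral_mult_left_zero)
    finally show ?thesis by (simp add: F_def)
  qed
  have cS: "continuous_on {0..1} (\<lambda>u. S (p u) * f (p u) * (b - a))"
  proof -
    have "continuous_on (closed_segment a b) S"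
      by (rule continuous_on_subset[OF holomorphic_on_imp_continuous_on[OF S_holomorphic]]) (use seg in blast)
    then have "continuous_on {0..1} (\<lambda>u. S (p u))"
      by (rule continuous_on_compose2[OF _ p(1)]) (simp add: p(2))
    then show ?thesis by (intro continuous_intros fp)
  qed
  have "contour_integral p (\<lambda>z. S z * f z) = integral {0..1} (\<lambda>u. S (p u) * f (p u) * (b - a))"
    by (simp add: p_def contour_integral_integral)
  also have "\<dots> = (LINT u:{0..1}|lborel. S (p u) * f (p u) * (b - a))"
    by (rule set_borel_integral_eq_integral(2)[symmetric]) (rule borel_integrable_atLeastAtMost'[OF cS])
  also have "\<dots> = (LINT u|lborel. LINT x|M. G x u)"
    by (simp only: intu set_lebesgue_integral_def)
  also have "\<dots> = (LINT x|M. LINT u|lborel. G x u)"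
    by (rule P.Fubini_integral[OF iG])
  finally show "contour_integral (linepath a b) (\<lambda>z. S z * f z) = (LINT x|M. I x)"
    by (simp add: p_def intx)
qed

section \<open>Deformation of the contour and residues\<close>

lemma real_on_triangle:
  assumes "Re z0 = l" "Im z0 > 0" "a \<in> {cnj z0, 0, z0}" "b \<in> {cnj z0, 0, z0}" "of_real x \<in> closed_segment a b"
  shows "x = 0 \<or> x = l"
proof -
  from assms(5) obtain u where "of_real x = (1 - u) *\<^sub>R a + u *\<^sub>R b"
    by (auto simp: closed_segment_def)
  then have "Re (of_real x) = Re ((1 - u) *\<^sub>R a + u *\<^sub>R b)" "Im (of_real x) = Im ((1 - u) *\<^sub>R a + u *\<^sub>R b)"
    by simp_all
  then have "x = (1 - u) * Re a + u * Re b" "0 = (1 - u) * Im a + u * Im b" by simp_all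
  then show ?thesis using assms(1-4) by (auto simp: algebra_simps)
qed

text \<open>The integrand is holomorphic on the plane slit along [m, \<infinity>), which is starlike
  about 0 and contains \<Gamma>. The vertical segment passes through l and so leaves this domain;
  the path through 0 is the intermediate step.\<close>

lemma contour_integral_deform:
  assumes f: "f holomorphic_on - of_real ` {l..}" and l: "l > 0" and z0: "Re z0 = l" "Im z0 > 0"
    and g: "valid_path g" "pathstart g = cnj z0" "pathfinish g = z0" "path_image g \<inter> of_real ` {0<..} = {}"
  shows "contour_integral g (\<lambda>z. S z * f z) =
    contour_integral (linepath (cnj z0) 0) (\<lambda>z. S z * f z) + contour_integral (linepath 0 z0) (\<lambda>z. S z * f z)"
proof -
  define m where "m = min c l"
  define U where "U = (- of_real ` {m..} :: complex set)"
  have m: "m > 0" using c_pos l by (simp add: m_def)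
  have "closed (of_real ` {m..} :: complex set)"
    by (intro closed_injective_linear_image) (auto intro: injI linearI simp: scaleR_conv_of_real)
  then have opU: "open U" by (auto simp: U_def)
  \<comment> \<open>If u z = y \<ge> m with 0 < u \<le> 1, then z = y/u \<ge> m already lies on the
    slit.\<close>
  have segU: "closed_segment 0 z \<subseteq> U" if "z \<in> U" for z
  proof
    fix w assume "w \<in> closed_segment 0 z"
    then obtain u where u: "0 \<le> u" "u \<le> 1" "w = of_real u * z"
      by (auto simp: closed_segment_def scaleR_conv_of_real)
    show "w \<in> U"
    proof (rule ccontr)
      assume "w \<notin> U"
      then obtain y where y: "y \<ge> m" "w = of_real y" by (auto simp: U_def)
      then have "u \<noteq> 0" using u m by auto
      moreover have "m * u \<le> y" using mult_left_le[of u m] u m y by linarith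
      ultimately have "z = of_real (y / u)" "y / u \<ge> m"
        using u y by (auto simp: field_simps)
      then show False using that unfolding U_def by (metis ComplD atLeast_iff imageI)
    qed
  qed
  have "0 \<in> U" using m by (auto simp: U_def)
  then have starU: "starlike U" using segU by (auto simp: starlike_def)
  have "S holomorphic_on U"
    by (rule holomorphic_on_subset[OF S_holomorphic]) (auto simp: U_def K_def m_def)
  moreover have "f holomorphic_on U"
    by (rule holomorphic_on_subset[OF f]) (auto simp: U_def m_def)
  ultimately have hol: "(\<lambda>z. S z * f z) holomorphic_on U" by (rule holomorphic_on_mult)
  have z0U: "z0 \<in> U" "cnj z0 \<in> U" using z0 by (auto simp: U_def complex_eq_iff)
  have seg: "closed_segment z0 0 \<subseteq> U" "closed_segment 0 (cnj z0) \<subseteq> U" "closed_segment 0 z0 \<subseteq> U"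
    "closed_segment (cnj z0) 0 \<subseteq> U"
    using segU[OF z0U(1)] segU[OF z0U(2)] by (auto simp: closed_segment_commute)
  have gU: "path_image g \<subseteq> U" using g(4) m by (fastforce simp: U_def)
  have cont: "continuous_on A (\<lambda>z. S z * f z)" if "A \<subseteq> U" for A
    using hol that holomorphic_on_imp_continuous_on continuous_on_subset by blast
  have int: "(\<lambda>z. S z * f z) contour_integrable_on g"
    "(\<lambda>z. S z * f z) contour_integrable_on linepath z0 0"
    "(\<lambda>z. S z * f z) contour_integrable_on linepath 0 (cnj z0)"
    using contour_integrable_holomorphic_simple[OF hol opU g(1) gU] cont seg
    by (auto intro!: contour_integrable_continuous_linepath)
  have "((\<lambda>z. S z * f z) has_contour_integral 0) (g +++ linepath z0 0 +++ linepath 0 (cnj z0))"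
    by (rule Cauchy_theorem_starlike_simple[OF opU starU hol])
      (use g gU seg in \<open>auto simp: path_image_join valid_path_join\<close>)
  then have "contour_integral (g +++ linepath z0 0 +++ linepath 0 (cnj z0)) (\<lambda>z. S z * f z) = 0"
    by (rule contour_integral_unique)
  then have "contour_integral g (\<lambda>z. S z * f z) + (contour_integral (linepath z0 0) (\<lambda>z. S z * f z)
      + contour_integral (linepath 0 (cnj z0)) (\<lambda>z. S z * f z)) = 0"
    using int g by (simp add: contour_integrable_join valid_path_join)
  moreover have "contour_integral (linepath z0 0) (\<lambda>z. S z * f z) = - contour_integral (linepath 0 z0) (\<lambda>z. S z * f z)"
    by (rule contour_integral_reverse_linepath) (use cont seg in auto)
  moreover have "contour_integral (linepath 0 (cnj z0)) (\<lambda>z. S z * f z) = - contour_integral (linepath (cnj z0) 0) (\<lambda>z. S z * f z)"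
    by (rule contour_integral_reverse_linepath) (use cont seg in auto)
  ultimately show ?thesis by (simp add: add_eq_0_iff2)
qed

text \<open>Cauchy's theorem for a single pole x, in the closed half-plane Re z \<le> l, where
  \<open>f\<close> only has to be continuous up to the boundary. For x < l the pole lies inside the
  triangle; for x > l the integrand is regular in the half-plane.\<close>

lemma triangle_integral:
  assumes f: "continuous_on {z. Re z \<le> l} f" "f holomorphic_on {z. Re z < l}"
    and l: "l > 0" and z0: "Re z0 = l" "Im z0 > 0" and x: "x > 0" "x \<noteq> l"
  shows "contour_integral (linepath (cnj z0) 0) (\<lambda>z. inverse (of_real x - z) * f z) +
     contour_integral (linepath 0 z0) (\<lambda>z. inverse (of_real x - z) * f z) =
     (if x < l then 2 * of_real pi * \<i> * f (of_real x) else 0) +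
     contour_integral (linepath (cnj z0) z0) (\<lambda>z. inverse (of_real x - z) * f z)"
proof -
  define H where "H = {z. Re z \<le> l}"
  define h where "h = (\<lambda>z. inverse (of_real x - z) * f z)"
  define T where "T = linepath (cnj z0) 0 +++ linepath 0 z0 +++ linepath z0 (cnj z0)"
  have convH: "convex H" unfolding H_def by (rule convex_halfspace_Re_le)
  have "interior H = {z. Re z < l}"
    using interior_halfspace_le[of "1::complex" l] by (simp add: H_def inner_complex_def)
  then have difff: "f field_differentiable at z" if "z \<in> interior H" for z
    using that f(2) holomorphic_on_imp_differentiable_at open_halfspace_Re_lt by blast
  have segH: "closed_segment a b \<subseteq> H" if "a \<in> {cnj z0, 0, z0}" "b \<in> {cnj z0, 0, z0}" for a b
    using that z0 l by (intro closed_segment_subset convH) (auto simp: H_def)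
  have xseg: "of_real x \<notin> closed_segment a b" if "a \<in> {cnj z0, 0, z0}" "b \<in> {cnj z0, 0, z0}" for a b
    using real_on_triangle[OF z0 that] x by blast
  have ch: "continuous_on (closed_segment a b) h" if "a \<in> {cnj z0, 0, z0}" "b \<in> {cnj z0, 0, z0}" for a b
    unfolding h_def using xseg[OF that]
    by (intro continuous_intros continuous_on_subset[OF f(1)]) (use segH[OF that] in \<open>auto simp: H_def\<close>)
  have int: "h contour_integrable_on linepath a b" if "a \<in> {cnj z0, 0, z0}" "b \<in> {cnj z0, 0, z0}" for a b
    using ch[OF that] by (rule contour_integrable_continuous_linepath)
  have path: "valid_path T" "pathfinish T = pathstart T" "path_image T \<subseteq> H - {of_real x}"
    using segH xseg by (auto simp: T_def valid_path_join path_image_join)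
  have "contour_integral T h = (if x < l then 2 * of_real pi * \<i> * f (of_real x) else 0)"
  proof (cases "x < l")
    case True
    have nc: "\<not> collinear {cnj z0, 0, z0}"
    proof
      assume "collinear {cnj z0, 0, z0}"
      then have "collinear {0, cnj z0, z0}" by (simp add: insert_commute)
      then have "cnj z0 = 0 \<or> z0 = 0 \<or> (\<exists>r. z0 = r *\<^sub>R cnj z0)" by (simp only: collinear_lemma)
      then obtain r where "z0 = r *\<^sub>R cnj z0" using l z0 by auto
      then have "Re z0 = Re (r *\<^sub>R cnj z0)" "Im z0 = Im (r *\<^sub>R cnj z0)" by simp_all
      then show False using l z0 by auto
    qed
    have "of_real x \<in> interior (convex hull {cnj z0, 0, z0})"
    proof -
      \<comment> \<open>Barycentric coordinates of x: equal weights on the conjugate vertices cancel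
        the imaginary part, and Re z0 = l fixes their size.\<close>
      have "(x / (2 * l)) *\<^sub>R cnj z0 + (1 - x / l) *\<^sub>R 0 + (x / (2 * l)) *\<^sub>R z0 = of_real x"
        using z0 l by (simp add: complex_eq_iff)
      moreover have "0 < x / (2 * l)" "0 < 1 - x / l" "x / (2 * l) + (1 - x / l) + x / (2 * l) = 1"
        using x l True by (auto simp: field_simps)
      ultimately show ?thesis
        unfolding interior_convex_hull_3_minimal[OF nc DIM_complex] mem_Collect_eq by metis
    qed
    then have "winding_number T (of_real x) = (if 0 < Im ((0 - cnj z0) * cnj (0 - of_real x)) then 1 else - 1)"
      unfolding T_def by (rule winding_number_triangle)
    \<comment> \<open>The triangle is traversed clockwise. This sign cancels the one in 1/(x - z) =
      -1/(z - x).\<close>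
    also have "\<dots> = -1" using x z0 by (simp add: mult_less_0_iff not_less)
    finally have wn: "winding_number T (of_real x) = -1" .
    have "((\<lambda>w. f w / (w - of_real x)) has_contour_integral (2 * pi * \<i> * winding_number T (of_real x) * f (of_real x))) T"
    proof (rule Cauchy_integral_formula_convex[OF convH finite.emptyI])
      show "of_real x \<in> interior H" using True \<open>interior H = _\<close> by simp
    qed (use f path difff in \<open>auto simp: H_def\<close>)
    then have "((\<lambda>w. - (f w / (w - of_real x))) has_contour_integral (2 * pi * \<i> * f (of_real x))) T"
      unfolding wn by (auto dest: has_contour_integral_neg)
    moreover have "- (f w / (w - of_real x)) = h w" for w
      unfolding h_def minus_divide_right by (simp add: divide_inverse mult.commute)
    ultimately show ?thesis using True by (simp add: contour_integral_unique)
  next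
    case False
    have "(h has_contour_integral 0) T"
    proof (rule Cauchy_theorem_convex[OF _ convH finite.emptyI])
      have nz: "of_real x - z \<noteq> 0" if "z \<in> H" for z using that False x by (auto simp: H_def)
      show "continuous_on H h" unfolding h_def using nz f(1) by (intro continuous_intros) (auto simp: H_def)
      fix z assume "z \<in> interior H - {}"
      then show "h field_differentiable at z" unfolding h_def using nz interior_subset[of H]
        by (intro derivative_intros field_differentiable_mult field_differentiable_inverse difff) auto
    qed (use path in auto)
    then show ?thesis using False by (simp add: contour_integral_unique)
  qed
  moreover have "contour_integral T h = contour_integral (linepath (cnj z0) 0) h + (contour_integral (linepath 0 z0) h + contour_integral (linepath z0 (cnj z0)) h)"
    unfolding T_def using int by (simp add: contour_integrable_join valid_path_join)
  moreover have "contour_integral (linepath z0 (cnj z0)) h = - contour_integral (linepath (cnj z0) z0) h"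
    by (rule contour_integral_reverse_linepath) (use ch in auto)
  ultimately show ?thesis unfolding h_def[symmetric] by (simp add: algebra_simps)
qed

text \<open>S has its singularities inside the triangle, so the integral over \<open>M\<close> is
  first taken outside on each of the three sides; the one-pole identity
  \<open>triangle_integral\<close> then holds for every x in \<open>K\<close> and is
  integrated.\<close>

lemma contour_integral_residues:
  assumes f: "continuous_on {z. Re z \<le> l} f" "f holomorphic_on - of_real ` {l..}"
    and l: "l > 0" and z0: "Re z0 = l" "Im z0 > 0"
    and g: "valid_path g" "pathstart g = cnj z0" "pathfinish g = z0" "path_image g \<inter> of_real ` {0<..} = {}"
  shows "contour_integral g (\<lambda>z. S z * f z) =
     2 * of_real pi * \<i> * (LINT x|M. indicator K x *\<^sub>R (if x < l then f (of_real x) else 0)) +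
     contour_integral (linepath (cnj z0) z0) (\<lambda>z. S z * f z)"
proof -
  define I where "I = (\<lambda>a b x. indicator K x *\<^sub>R contour_integral (linepath a b) (\<lambda>z. inverse (of_real x - z) * f z))"
  have real0: "Im z = 0 \<Longrightarrow> z = of_real (Re z)" for z by (simp add: complex_eq_iff)
  have fseg: "continuous_on (closed_segment a b) f" if "a \<in> {cnj z0, 0, z0}" "b \<in> {cnj z0, 0, z0}" for a b
  proof (rule continuous_on_subset[OF f(1)])
    show "closed_segment a b \<subseteq> {z. Re z \<le> l}"
      using that z0 l by (intro closed_segment_subset convex_halfspace_Re_le) auto
  qed
  have Kseg: "closed_segment a b \<inter> of_real ` K = {}" if "a \<in> {cnj z0, 0, z0}" "b \<in> {cnj z0, 0, z0}" for a b
  proof -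
    have "0 \<notin> K" "l \<notin> K" using c_pos d_pos by (auto simp: K_def)
    then show ?thesis using real_on_triangle[OF z0 that] by blast
  qed
  have hol: "f holomorphic_on {z. Re z < l}"
    by (rule holomorphic_on_subset[OF f(2)]) auto
  have F: "integrable M (I a b)" "contour_integral (linepath a b) (\<lambda>z. S z * f z) = (LINT x|M. I a b x)"
    if "a \<in> {cnj z0, 0, z0}" "b \<in> {cnj z0, 0, z0}" for a b
    using contour_integral_S[OF Kseg[OF that] fseg[OF that]] by (simp_all add: I_def)
  have eq: "I (cnj z0) 0 x + I 0 z0 x - I (cnj z0) z0 x = 2 * of_real pi * \<i> * (indicator K x *\<^sub>R (if x < l then f (of_real x) else 0))" for x
  proof (cases "x \<in> K")
    case True
    then have "x > 0" "x \<noteq> l" using K_pos d_pos by (auto simp: K_def)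
    then show ?thesis
      using triangle_integral[OF f(1) hol l z0, of x] True
      by (simp add: I_def algebra_simps)
  qed (simp add: I_def)
  have "contour_integral (linepath (cnj z0) 0) (\<lambda>z. S z * f z) + contour_integral (linepath 0 z0) (\<lambda>z. S z * f z)
     - contour_integral (linepath (cnj z0) z0) (\<lambda>z. S z * f z) = (LINT x|M. I (cnj z0) 0 x + I 0 z0 x - I (cnj z0) z0 x)"
    by (simp add: F)
  also have "\<dots> = 2 * of_real pi * \<i> * (LINT x|M. indicator K x *\<^sub>R (if x < l then f (of_real x) else 0))"
    by (simp only: eq integral_mult_right_zero)
  finally show ?thesis
    using contour_integral_deform[OF f(2) l z0 g] by (simp add: algebra_simps)
qed

section \<open>The error as an integral over the vertical segment, and its two bounds\<close>

lemma vertical_notin_K: "Re z = l \<Longrightarrow> z \<notin> of_real ` K"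
  using d_pos by (auto simp: K_def)

text \<open>An exact formula: the residues add up to the Riesz mean, and the vertical segment
  contributes 2 i b Re G by conjugation symmetry, of which division by 2 pi i leaves (b/pi) Re
  G.\<close>

lemma riesz_difference:
  fixes \<alpha> b :: real
  defines "f \<equiv> (\<lambda>z. (1 - z / of_real l) powr of_real \<alpha>)"
  defines "G \<equiv> integral {0..1} (\<lambda>u. S (Complex l (b * u)) * f (Complex l (b * u)))"
  assumes l: "l > 0" and a: "\<alpha> > 0" and b: "b > 0" and z0: "z0 = Complex l b"
    and g: "valid_path g" "pathstart g = cnj z0" "pathfinish g = z0" "path_image g \<inter> of_real ` {0<..} = {}"
  shows "cmod (of_real (LINT x|M. indicator {0<..l} x *\<^sub>R (1 - x / l) powr \<alpha>)
      - 1 / (2 * of_real pi * \<i>) * contour_integral g (\<lambda>z. S z * f z)) = b / pi * \<bar>Re G\<bar>"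
proof -
  have cz: "cnj z0 = Complex l (- b)" "Re z0 = l" "Im z0 > 0" using b z0 by (simp_all add: complex_cnj)
  have "f (of_real x) = of_real ((1 - x / l) powr \<alpha>)" if "x < l" for x
    using that l powr_of_real[of "1 - x / l" \<alpha>] by (simp add: f_def)
  then have "(\<lambda>x. indicator K x *\<^sub>R (if x < l then f (of_real x) else 0)) =
      (\<lambda>x. indicator K x *\<^sub>R (if x < l then of_real ((1 - x / l) powr \<alpha>) else 0))"
    by auto
  then have "(LINT x|M. indicator K x *\<^sub>R (if x < l then f (of_real x) else 0)) =
      (LINT x|M. indicator K x *\<^sub>R (if x < l then of_real ((1 - x / l) powr \<alpha>) else 0))"
    by simp
  \<comment> \<open>Points of \<open>K\<close> are positive and different from l, so on
    \<open>K\<close> the conditions x < l and x \<in> (0, l] agree.\<close>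
  also have "\<dots> = (LINT x|M. of_real (indicator {0<..l} x *\<^sub>R (1 - x / l) powr \<alpha>))"
  proof (rule integral_cong_AE)
    show "AE x in M. indicator K x *\<^sub>R (if x < l then of_real ((1 - x / l) powr \<alpha>) else 0)
        = complex_of_real (indicator {0<..l} x *\<^sub>R (1 - x / l) powr \<alpha>)"
      using AE_K
    proof eventually_elim
      fix x assume x: "x \<in> K"
      then have "x > 0" "x \<noteq> l" using K_pos d_pos by (auto simp: K_def)
      then show "indicator K x *\<^sub>R (if x < l then of_real ((1 - x / l) powr \<alpha>) else 0)
        = complex_of_real (indicator {0<..l} x *\<^sub>R (1 - x / l) powr \<alpha>)"
        using x by (simp add: indicator_def)
    qed
  qed simp_all
  also have "\<dots> = of_real (LINT x|M. indicator {0<..l} x *\<^sub>R (1 - x / l) powr \<alpha>)"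
    by (rule integral_complex_of_real)
  finally have R: "(LINT x|M. indicator K x *\<^sub>R (if x < l then f (of_real x) else 0)) =
    complex_of_real (LINT x|M. indicator {0<..l} x *\<^sub>R (1 - x / l) powr \<alpha>)" .
  have seg: "closed_segment (Complex l (-b)) (Complex l b) \<subseteq> {z. Re z = l}"
    by (auto simp: closed_segment_def left_diff_distrib)
  note nK = vertical_notin_K
  have fc: "continuous_on {z. Re z \<le> l} f" unfolding f_def using continuous_on_riesz_kernel[OF l a] .
  have hf: "f holomorphic_on - of_real ` {l..}" unfolding f_def using holomorphic_on_riesz_kernel[OF l] .
  have "continuous_on (closed_segment (Complex l (-b)) (Complex l b)) (\<lambda>z. S z * f z)"
    by (intro continuous_on_mult continuous_on_subset[OF fc] continuous_on_subset[OF holomorphic_on_imp_continuous_on[OF S_holomorphic]])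
      (use seg nK in auto)
  then have V: "contour_integral (linepath (cnj z0) z0) (\<lambda>z. S z * f z) = \<i> * of_real (2 * b * Re G)"
    unfolding G_def z0 cz(1)[unfolded z0]
    by (rule contour_integral_vertical_symmetric) (use riesz_kernel_cnj[OF l] in \<open>auto simp: S_cnj f_def\<close>)
  have "contour_integral g (\<lambda>z. S z * f z) = 2 * of_real pi * \<i> * of_real (LINT x|M. indicator {0<..l} x *\<^sub>R (1 - x / l) powr \<alpha>)
      + \<i> * of_real (2 * b * Re G)"
    using contour_integral_residues[OF fc hf l cz(2,3) g] by (simp only: R V)
  then have "of_real (LINT x|M. indicator {0<..l} x *\<^sub>R (1 - x / l) powr \<alpha>)
      - 1 / (2 * of_real pi * \<i>) * contour_integral g (\<lambda>z. S z * f z) = - of_real (b / pi * Re G)"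
    by (simp add: field_simps)
  then show ?thesis using b by (simp add: abs_mult del: of_real_mult of_real_divide)
qed

lemma riesz_remainder_bound:
  fixes \<alpha> b :: real
  defines "f \<equiv> (\<lambda>z. (1 - z / of_real l) powr of_real \<alpha>)"
  defines "G \<equiv> integral {0..1} (\<lambda>u. S (Complex l (b * u)) * f (Complex l (b * u)))"
  assumes l: "l > 0" and a: "\<alpha> > 0" and b: "b > 0"
  shows "\<bar>Re G\<bar> \<le> (b / l) powr \<alpha> * cmod (S (Complex l b)) / \<alpha>"
proof -
  have fc: "continuous_on {z. Re z \<le> l} f" unfolding f_def using continuous_on_riesz_kernel[OF l a] .
  note nK = vertical_notin_K
  have cC: "continuous_on {0..1} (\<lambda>u. Complex l (b * u))"
    by (auto simp: Complex_eq intro!: continuous_intros)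
  have "continuous_on {0..1} (\<lambda>u. S (Complex l (b * u)) * f (Complex l (b * u)))"
    by (intro continuous_on_mult continuous_on_compose2[OF fc cC]
        continuous_on_compose2[OF holomorphic_on_imp_continuous_on[OF S_holomorphic] cC]) (simp_all add: image_subset_iff nK)
  then have 1: "((\<lambda>u. S (Complex l (b * u)) * f (Complex l (b * u))) has_integral G) {0..1}"
    unfolding G_def by (intro integrable_integral integrable_continuous_interval)
  have 2: "((\<lambda>u. (b / l) powr \<alpha> * cmod (S (Complex l b)) * u powr (\<alpha> - 1)) has_integral
      (b / l) powr \<alpha> * cmod (S (Complex l b)) * (1 / \<alpha>)) {0..1}"
    using has_integral_powr_from_0[of "\<alpha> - 1" 1] a by (intro has_integral_mult_right) simp
  have "norm (S (Complex l (b * u)) * f (Complex l (b * u))) \<le> (b / l) powr \<alpha> * cmod (S (Complex l b)) * u powr (\<alpha> - 1)"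
    if "u \<in> {0..1}" for u
  proof (cases "u = 0")
    case False
    then have u: "0 < u" "u \<le> 1" using that by auto
    \<comment> \<open>Monotonicity along the line costs one factor u, which turns the u^\<alpha> of
      the kernel into the integrable u^(\<alpha>-1).\<close>
    have "b * u * cmod (S (Complex l (b * u))) \<le> b * cmod (S (Complex l b))"
      using u b by (intro S_vertical_mono) (auto intro: mult_left_le)
    then have "u * cmod (S (Complex l (b * u))) \<le> cmod (S (Complex l b))" using b by simp
    then have "u powr (\<alpha> - 1) * (b / l) powr \<alpha> * (u * cmod (S (Complex l (b * u)))) \<le> u powr (\<alpha> - 1) * (b / l) powr \<alpha> * cmod (S (Complex l b))"
      by (intro mult_left_mono) auto
    moreover have "cmod (f (Complex l (b * u))) = (b / l) powr \<alpha> * (u * u powr (\<alpha> - 1))"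
    proof -
      have "cmod (f (Complex l (b * u))) = (b / l * u) powr \<alpha>"
        unfolding f_def using u b l by (simp add: riesz_kernel_vertical norm_mult)
      also have "\<dots> = (b / l) powr \<alpha> * u powr \<alpha>" using u b l by (intro powr_mult)
      also have "u powr \<alpha> = u * u powr (\<alpha> - 1)" using u by (simp add: powr_mult_base)
      finally show ?thesis .
    qed
    ultimately show ?thesis by (simp add: norm_mult mult_ac)
  \<comment> \<open>At u = 0 the kernel vanishes, and so does \<open>u powr (\<alpha> - 1)\<close>
    by the convention for \<open>0 powr\<close>.\<close>
  qed (use l a in \<open>simp add: f_def riesz_kernel_vertical\<close>)
  from has_integral_norm_bound_integral_component[where k = 1, OF 1 2] this
  have "norm G \<le> (b / l) powr \<alpha> * cmod (S (Complex l b)) / \<alpha>" by simp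
  then show ?thesis using abs_Re_le_cmod order_trans by blast
qed

text \<open>With s = (x - l)/b, the real and imaginary parts of 1/(x - z) are s/(s^2 + 1) and 1/(s^2
  + 1), each divided by b. So \<open>vertical_kernel_estimate\<close> compares the x-integrand of Re
  G with Re and Im of the integrand of S z, and integrates to a bound by Re (S z) and Im (S
  z).\<close>

lemma riesz_remainder_bound_less_one:
  fixes \<alpha> b :: real
  defines "f \<equiv> (\<lambda>z. (1 - z / of_real l) powr of_real \<alpha>)"
  defines "G \<equiv> integral {0..1} (\<lambda>u. S (Complex l (b * u)) * f (Complex l (b * u)))"
  assumes l: "l > 0" and a: "0 < \<alpha>" "\<alpha> < 1" and b: "b > 0"
  shows "\<bar>Re G\<bar> \<le> (b / l) powr \<alpha> * (sqrt (1 + pi\<^sup>2 / 4) * cmod (S (Complex l b)))"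
proof -
  define \<theta> where "\<theta> = pi * \<alpha> / 2"
  define z where "z = Complex l b"
  define C where "C = cos \<theta> / (\<alpha> + 1)"
  define D where "D = sin \<theta> / \<alpha>"
  define k where "k = (b / l) powr \<alpha>"
  define I where "I = (\<lambda>x. indicator K x *\<^sub>R contour_integral (linepath (of_real l) z) (\<lambda>w. inverse (of_real x - w) * f w))"
  have th: "0 < \<theta>" "\<theta> < pi / 2" using a by (auto simp: \<theta>_def)
  have "cos \<theta> \<le> \<alpha> + 1" using cos_le_one[of \<theta>] a by linarith
  then have C: "\<bar>C\<bar> \<le> 1"
    using a cos_gt_zero[OF th] by (simp add: C_def)
  \<comment> \<open>Here \<theta>/\<alpha> = pi/2, the weight of |Im S| in the final Cauchy-Schwarz
    step.\<close>
  have "sin \<theta> \<le> \<theta>" using th by (intro sin_x_le_x) simp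
  then have D: "0 \<le> D" "D \<le> pi / 2"
    using a sin_gt_zero[of \<theta>] th by (auto simp: D_def \<theta>_def field_simps)
  have fc: "continuous_on {z. Re z \<le> l} f" unfolding f_def using continuous_on_riesz_kernel[OF l a(1)] .
  have seg: "closed_segment (of_real l) z \<subseteq> {z. Re z = l}"
    by (auto simp: closed_segment_def z_def left_diff_distrib)
  note nK = vertical_notin_K
  have zK: "z \<notin> of_real ` K" using nK[of z] by (simp add: z_def)
  have "closed_segment (of_real l) z \<inter> of_real ` K = {}" using seg nK by blast
  moreover have "continuous_on (closed_segment (of_real l) z) f"
    by (rule continuous_on_subset[OF fc]) (use seg in auto)
  ultimately have "integrable M I" "contour_integral (linepath (of_real l) z) (\<lambda>w. S w * f w) = (LINT x|M. I x)"
    unfolding I_def by (rule contour_integral_S)+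
  then have I: "integrable M I" "\<i> * of_real b * G = (LINT x|M. I x)"
    by (simp_all add: z_def contour_integral_vertical G_def)
  \<comment> \<open>Division by the velocity i b of the path turns the contour integral into the
    plain integral over [0,1] that defines \<open>G\<close>.\<close>
  define J where "J = (\<lambda>x. Re (I x / (\<i> * of_real b)))"
  have J: "integrable M J" "Re G = (LINT x|M. J x)"
  proof -
    have i: "integrable M (\<lambda>x. I x / (\<i> * of_real b))" using I(1) by simp
    then show "integrable M J" unfolding J_def by simp
    have "G = (LINT x|M. I x / (\<i> * of_real b))" using I(2) b by (simp add: field_simps)
    then show "Re G = (LINT x|M. J x)" unfolding J_def using i by simp
  qed
  define w where "w = (\<lambda>x. inverse (complex_of_real x - z))"
  have w: "integrable M w" unfolding w_def by (rule integrable_inverse_powers(1)[OF zK])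
  have Sw: "S z = (LINT x|M. w x)" by (simp add: S_def w_def)
  have est: "\<bar>J x - k * C * Re (w x)\<bar> \<le> k * D * Im (w x)" if x: "x \<in> K" for x
  proof -
    define s where "s = (x - l) / b"
    have s0: "s \<noteq> 0" using x d_pos b by (auto simp: s_def K_def)
    have xs: "x = l + b * s" using b by (simp add: s_def)
    define E where "E = integral {0..1} (\<lambda>u. u powr \<alpha> * (s * cos \<theta> + u * sin \<theta>) / (s\<^sup>2 + u\<^sup>2))"
    have pos: "s\<^sup>2 + u\<^sup>2 > 0" for u using s0 by (simp add: sum_power2_gt_zero_iff)
    have "J x = Re (integral {0..1} (\<lambda>u. inverse (of_real x - Complex l (b * u)) * f (Complex l (b * u))))"
      using x b by (simp add: J_def I_def z_def contour_integral_vertical)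
    also have "\<dots> = integral {0..1} (\<lambda>u. Re (inverse (of_real x - Complex l (b * u)) * f (Complex l (b * u))))"
    proof -
      have cC: "continuous_on {0..1} (\<lambda>u. Complex l (b * u))"
        by (auto simp: Complex_eq intro!: continuous_intros)
      have "continuous_on {0..1} (\<lambda>u. inverse (of_real x - Complex l (b * u)) * f (Complex l (b * u)))"
        by (intro continuous_intros cC continuous_on_compose2[OF fc cC])
          (use x d_pos in \<open>auto simp: complex_eq_iff K_def\<close>)
      from integrable_integral[OF integrable_continuous_interval[OF this]]
      show ?thesis by (rule integral_unique[OF has_integral_Re, symmetric])
    qed
    also have "\<dots> = integral {0..1} (\<lambda>u. k / b * (u powr \<alpha> * (s * cos \<theta> + u * sin \<theta>) / (s\<^sup>2 + u\<^sup>2)))"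
    proof (rule Henstock_Kurzweil_Integration.integral_cong)
      fix u :: real assume u: "u \<in> {0..1}"
      have "f (Complex l (b * u)) = of_real (k * u powr \<alpha>) * cis (- \<theta>)"
        unfolding f_def k_def \<theta>_def using l b u
        by (subst riesz_kernel_vertical) (auto simp: powr_mult[symmetric] simp del: of_real_mult)
      moreover have "inverse (of_real x - Complex l (b * u)) = inverse (of_real b) * (inverse (Complex s (- u)))"
        unfolding xs inverse_mult_distrib[symmetric] by (rule arg_cong[of _ _ inverse]) (simp add: complex_eq_iff)
      ultimately have "inverse (of_real x - Complex l (b * u)) * f (Complex l (b * u)) =
         of_real (k * u powr \<alpha> / b) * (inverse (Complex s (- u)) * cis (- \<theta>))"
        by (simp add: field_simps)
      then have "Re (inverse (of_real x - Complex l (b * u)) * f (Complex l (b * u))) =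
         k * u powr \<alpha> / b * Re (inverse (Complex s (- u)) * cis (- \<theta>))" by (simp only: scaleR_conv_of_real[symmetric] scaleR_complex.sel)
      also have "Re (inverse (Complex s (- u)) * cis (- \<theta>)) = (s * cos \<theta> + u * sin \<theta>) / (s\<^sup>2 + u\<^sup>2)"
        by (simp add: add_divide_distrib)
      finally show "Re (inverse (of_real x - Complex l (b * u)) * f (Complex l (b * u))) =
        k / b * (u powr \<alpha> * (s * cos \<theta> + u * sin \<theta>) / (s\<^sup>2 + u\<^sup>2))" by simp
    qed
    also have "\<dots> = k / b * E" unfolding E_def by (rule integral_mult_right)
    finally have JE: "J x = k / b * E" .
    have "w x = inverse (of_real b) * (inverse (Complex s (- 1)))"
      unfolding xs w_def z_def inverse_mult_distrib[symmetric] by (rule arg_cong[of _ _ inverse]) (simp add: complex_eq_iff)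
    then have "w x = inverse (Complex s (- 1)) / of_real b" by (simp only: divide_inverse mult.commute)
    then have wx: "Re (w x) = s / (s\<^sup>2 + 1) / b" "Im (w x) = 1 / (s\<^sup>2 + 1) / b"
      by (simp_all only: Re_divide_of_real Im_divide_of_real) simp_all
    have "\<bar>E - C * (s / (s\<^sup>2 + 1))\<bar> \<le> D / (s\<^sup>2 + 1)"
      using vertical_kernel_estimate[OF s0 a] by (simp add: E_def C_def D_def \<theta>_def)
    then have "k / b * \<bar>E - C * (s / (s\<^sup>2 + 1))\<bar> \<le> k / b * (D / (s\<^sup>2 + 1))"
      using b by (intro mult_left_mono) (auto simp: k_def)
    also have "k / b * \<bar>E - C * (s / (s\<^sup>2 + 1))\<bar> = \<bar>k / b * (E - C * (s / (s\<^sup>2 + 1)))\<bar>"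
      using b by (simp add: abs_mult k_def)
    also have "k / b * (E - C * (s / (s\<^sup>2 + 1))) = J x - k * C * Re (w x)"
      by (simp add: JE wx algebra_simps)
    also have "k / b * (D / (s\<^sup>2 + 1)) = k * D * Im (w x)"
      by (simp add: wx)
    finally show ?thesis .
  qed
  have "\<bar>Re G - k * C * Re (S z)\<bar> = \<bar>LINT x|M. J x - k * C * Re (w x)\<bar>"
    using J w by (simp add: Sw)
  also have "\<dots> \<le> (LINT x|M. \<bar>J x - k * C * Re (w x)\<bar>)" by (rule integral_abs_bound)
  also have "\<dots> \<le> (LINT x|M. k * D * Im (w x))"
  proof (rule integral_mono_AE)
    show "AE x in M. \<bar>J x - k * C * Re (w x)\<bar> \<le> k * D * Im (w x)"
      using AE_K by eventually_elim (rule est)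
  qed (use J w in auto)
  also have "\<dots> = k * D * Im (S z)" using w by (simp add: Sw)
  finally have "\<bar>Re G\<bar> \<le> \<bar>k * C * Re (S z)\<bar> + k * D * Im (S z)" by linarith
  also have "\<dots> \<le> k * (1 * \<bar>Re (S z)\<bar> + pi / 2 * \<bar>Im (S z)\<bar>)"
  proof -
    have "\<bar>k * C * Re (S z)\<bar> = k * (\<bar>C\<bar> * \<bar>Re (S z)\<bar>)" by (simp add: abs_mult k_def)
    moreover have "\<bar>C\<bar> * \<bar>Re (S z)\<bar> \<le> 1 * \<bar>Re (S z)\<bar>" using C by (intro mult_right_mono) auto
    moreover have "D * Im (S z) \<le> pi / 2 * \<bar>Im (S z)\<bar>"
      using order_trans[OF mult_left_mono[OF abs_ge_self D(1)] mult_right_mono[OF D(2) abs_ge_zero]] .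
    ultimately have "\<bar>k * C * Re (S z)\<bar> + k * D * Im (S z) = k * (\<bar>C\<bar> * \<bar>Re (S z)\<bar> + D * Im (S z))"
       "\<bar>C\<bar> * \<bar>Re (S z)\<bar> + D * Im (S z) \<le> 1 * \<bar>Re (S z)\<bar> + pi / 2 * \<bar>Im (S z)\<bar>"
      by (simp_all add: algebra_simps)
    then show ?thesis by (simp add: mult_left_mono k_def)
  qed
  also have "\<dots> \<le> k * (sqrt (1 + pi\<^sup>2 / 4) * cmod (S z))"
    using abs_add_half_pi_abs_le[of "S z"] by (intro mult_left_mono) (auto simp: k_def)
  finally show ?thesis by (simp add: k_def z_def)
qed

end

section \<open>The measure of a nondecreasing function\<close>

text \<open>Writing the right limits as infima reduces the facts about the distribution function to
  order arguments; the lower bound on N covers the limit at 0.\<close>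

lemma tendsto_Inf_at_right:
  fixes N :: "real \<Rightarrow> real"
  assumes mono: "mono_on {0<..} N" and bdd: "bdd_below (N ` {0<..})" and y: "y \<ge> 0"
  shows "(N \<longlongrightarrow> Inf (N ` {y<..})) (at_right y)"
proof (rule order_tendstoI)
  have bdd': "bdd_below (N ` {y<..})" using y by (intro bdd_below_mono[OF bdd] image_mono) simp
  fix a
  show "\<forall>\<^sub>F x in at_right y. a < N x" if "a < Inf (N ` {y<..})"
    using eventually_at_right_less[of y]
  proof eventually_elim
    case (elim x)
    then have "Inf (N ` {y<..}) \<le> N x" by (simp add: cInf_lower[OF imageI bdd'])
    then show ?case using that by simp
  qed
  show "\<forall>\<^sub>F x in at_right y. N x < a" if less: "Inf (N ` {y<..}) < a"
  proof -
    obtain x0 where x0: "x0 > y" "N x0 < a"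
      using cInf_lessD[OF _ less] by auto
    have "N x < a" if "y < x" "x < x0" for x
    proof -
      have "N x \<le> N x0" using that x0 y by (intro mono_onD[OF mono]) auto
      then show ?thesis using x0 by simp
    qed
    then show ?thesis using x0 by (auto simp: eventually_at_right_field)
  qed
qed

text \<open>These are the two conditions under which \<open>interval_measure\<close> gives (a, b]
  the mass F b - F a. Right continuity: if F x < a, some N x0 < a with x0 > x bounds F on all of (x,
  x0).\<close>

lemma
  fixes N :: "real \<Rightarrow> real"
  assumes mono: "mono_on {0<..} N" and bdd: "bdd_below (N ` {0<..})"
  defines "F \<equiv> (\<lambda>x. Lim (at_right (max x 0)) N)"
  shows Lim_at_right_mono: "x \<le> y \<Longrightarrow> F x \<le> F y"
    and Lim_at_right_continuous: "continuous (at_right x) F"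
proof -
  have F: "F x = Inf (N ` {max x 0<..})" for x
    unfolding F_def by (rule tendsto_Lim[OF _ tendsto_Inf_at_right[OF mono bdd]]) simp_all
  have bdd': "bdd_below (N ` {max x 0<..})" for x
    by (intro bdd_below_mono[OF bdd] image_mono) simp
  show m: "F x \<le> F y" if "x \<le> y" for x y
    unfolding F using that by (intro cInf_superset_mono[OF _ bdd'] image_mono) auto
  show "continuous (at_right x) F"
    unfolding continuous_within
  proof (rule order_tendstoI)
    fix a
    show "\<forall>\<^sub>F z in at_right x. a < F z" if "a < F x"
      using eventually_at_right_less[of x]
    proof eventually_elim
      case (elim z)
      then show ?case using that m[of x z] by simp
    qed
    show "\<forall>\<^sub>F z in at_right x. F z < a" if less: "F x < a"
    proof -
      obtain x0 where x0: "x0 > max x 0" "N x0 < a"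
        using cInf_lessD[OF _ less[unfolded F]] by auto
      have "F z < a" if "x < z" "z < x0" for z
      proof -
        have "F z \<le> N x0" unfolding F using that x0 by (simp add: cInf_lower[OF imageI bdd'])
        then show ?thesis using x0 by simp
      qed
      then show ?thesis using x0 by (auto simp: eventually_at_right_field)
    qed
  qed
qed

text \<open>Where N is constant, so is its right-limit function, and an interval (a, b] with F a = F
  b is null. Applied near 0 and near l, this yields \<open>c\<close> and \<open>d\<close>.\<close>

lemma stieltjes_support_stieltjes_measure:
  fixes N :: "real \<Rightarrow> real"
  assumes mono: "mono_on {0<..} N" and N0: "\<forall>\<^sub>F x in at_right 0. N x = 0"
    and inv: "(\<integral>\<^sup>+x\<in>{0<..}. ennreal (inverse x) \<partial>stieltjes_measure N) < \<infinity>"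
    and l: "l > 0" "\<forall>\<^sub>F x in nhds l. N x = N l"
  obtains c d where "stieltjes_support (stieltjes_measure N) c d l"
proof -
  define F where "F = (\<lambda>x. Lim (at_right (max x 0)) N)"
  define M where "M = stieltjes_measure N"
  have M: "M = interval_measure F" by (simp add: M_def stieltjes_measure_def F_def)
  obtain e where e: "e > 0" "\<And>x. 0 < x \<Longrightarrow> x < e \<Longrightarrow> N x = 0"
    using N0 by (auto simp: eventually_at_right_field)
  obtain r where r: "r > 0" "\<And>x. \<bar>x - l\<bar> < r \<Longrightarrow> N x = N l"
    using l(2) by (auto simp: eventually_nhds_metric dist_real_def)
  have "N x \<ge> 0" if "x > 0" for x
  proof -
    have "N (min x (e / 2)) \<le> N x" using that e(1) by (intro mono_onD[OF mono]) auto
    then show ?thesis using e(2)[of "min x (e / 2)"] e(1) that by auto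
  qed
  then have bdd: "bdd_below (N ` {0<..})" by (intro bdd_belowI2[of _ 0]) simp
  have F_mono: "F x \<le> F y" if "x \<le> y" for x y
    unfolding F_def using Lim_at_right_mono[OF mono bdd that] .
  have F_cont: "continuous (at_right x) F" for x
    unfolding F_def using Lim_at_right_continuous[OF mono bdd] .
  have F_const: "F x = k" if "max x 0 < y" "\<And>z. max x 0 < z \<Longrightarrow> z < y \<Longrightarrow> N z = k" for x y k
    unfolding F_def
  proof (rule tendsto_Lim)
    have "\<forall>\<^sub>F z in at_right (max x 0). N z = k"
      unfolding eventually_at_right_field using that by blast
    then show "(N \<longlongrightarrow> k) (at_right (max x 0))" by (rule tendsto_eventually)
  qed simp
  have null: "{a<..b} \<in> null_sets M" if "a \<le> b" "F a = F b" for a b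
    using emeasure_interval_measure_Ioc[OF that(1) F_mono F_cont] that(2) by (auto simp: M null_sets_def)
  have F0: "F x = 0" if "x < e" for x using that e by (intro F_const[of x e]) auto
  \<comment> \<open>Halving keeps [l - s, l + s] inside (0, \<infinity>) and leaves room to the
    right of l + s, where the right limit still sees the constant value.\<close>
  define s where "s = min r l / 2"
  have s: "0 < s" "s < r" "s < l" using r(1) l(1) by (auto simp: s_def)
  have Fl: "F x = N l" if "l - s \<le> x" "x \<le> l + s" for x
    using that s r(1) by (intro F_const[of x "l + r"] r(2)) auto
  \<comment> \<open>The half-line up to e/2 is exhausted by countably many bounded intervals, each
    null.\<close>
  have "(\<Union>n. {- real n<..e / 2}) \<in> null_sets M"
    using e(1) by (intro null_sets_UN null) (auto simp: F0)
  then have 1: "AE x in M. x \<notin> (\<Union>n. {- real n<..e / 2})" by (rule AE_not_in)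
  have "{l - s<..l + s} \<in> null_sets M" using s by (intro null) (auto simp: Fl)
  then have 2: "AE x in M. x \<notin> {l - s<..l + s}" by (rule AE_not_in)
  have supp: "AE x in M. e / 2 \<le> x \<and> s \<le> \<bar>x - l\<bar>"
    using 1 2
  proof eventually_elim
    case (elim x)
    obtain n where "- x < real n" using reals_Archimedean2 by blast
    moreover have "x \<notin> {- real n<..e / 2}" using elim(1) by blast
    ultimately have "e / 2 < x" by auto
    then show ?case using elim(2) by auto
  qed
  have "stieltjes_support M (e / 2) s l"
  proof (intro stieltjes_support.intro stieltjes_support_axioms.intro supp)
    show "sigma_finite_measure M" unfolding M by (rule sigma_finite_interval_measure[OF F_mono F_cont])
    show "sets M = sets borel" by (simp add: M)
    show "integrable M inverse"
    proof (rule integrableI_bounded)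
      show "inverse \<in> borel_measurable M" by (simp add: M)
      have "(\<integral>\<^sup>+x. ennreal (norm (inverse x)) \<partial>M) = (\<integral>\<^sup>+x\<in>{0<..}. ennreal (inverse x) \<partial>M)"
      proof (rule nn_integral_cong_AE)
        show "AE x in M. ennreal (norm (inverse x)) = ennreal (inverse x) * indicator {0<..} x"
          using supp by eventually_elim (use e(1) in auto)
      qed
      also have "\<dots> < \<infinity>" using inv by (simp add: M_def)
      finally show "(\<integral>\<^sup>+x. ennreal (norm (inverse x)) \<partial>M) < \<infinity>" .
    qed
  qed (use e(1) s in auto)
  then show ?thesis using that by (simp add: M_def)
qed

section \<open>The two inequalities for N\<close>

theorem theorem1:
  fixes N :: "real \<Rightarrow> real" and l\<^sub>0 \<eta>\<^sub>0 :: real and \<zeta>\<^sub>0 :: complex and \<Gamma> :: "real \<Rightarrow> complex"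
  assumes "mono_on {0<..} N"
    and "\<forall>\<^sub>F x in at_right 0. N x = 0"
    and "(\<integral>\<^sup>+x\<in>{0<..}. ennreal (inverse x) \<partial>stieltjes_measure N) < \<infinity>"
    and "l\<^sub>0 > 0" and "\<eta>\<^sub>0 > 0" and "\<zeta>\<^sub>0 = Complex l\<^sub>0 \<eta>\<^sub>0"
    and "\<forall>\<^sub>F x in nhds l\<^sub>0. N x = N l\<^sub>0"
    and "valid_path \<Gamma>" and "pathstart \<Gamma> = cnj \<zeta>\<^sub>0" and "pathfinish \<Gamma> = \<zeta>\<^sub>0"
    and "path_image \<Gamma> \<inter> complex_of_real ` {0<..} = {}"
  shows "(\<forall>\<alpha>::real. \<alpha> > 0 \<longrightarrow>
            cmod (complex_of_real (riesz_mean N \<alpha> l\<^sub>0)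
                  - 1 / (2 * complex_of_real pi * \<i>) *
                    contour_integral \<Gamma> (\<lambda>\<zeta>. stieltjes_transform N \<zeta> *
                      (1 - \<zeta> / complex_of_real l\<^sub>0) powr complex_of_real \<alpha>))
            \<le> 1 / (\<alpha> * pi) * (\<eta>\<^sub>0 / l\<^sub>0) powr \<alpha> * \<eta>\<^sub>0 * cmod (stieltjes_transform N \<zeta>\<^sub>0))
       \<and> (\<forall>\<alpha>::real. 0 < \<alpha> \<and> \<alpha> < 1 \<longrightarrow>
            cmod (complex_of_real (riesz_mean N \<alpha> l\<^sub>0)
                  - 1 / (2 * complex_of_real pi * \<i>) *
                    contour_integral \<Gamma> (\<lambda>\<zeta>. stieltjes_transform N \<zeta> *
                      (1 - \<zeta> / complex_of_real l\<^sub>0) powr complex_of_real \<alpha>))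
            \<le> sqrt (1 / pi\<^sup>2 + 1 / 4) * (\<eta>\<^sub>0 / l\<^sub>0) powr \<alpha> * \<eta>\<^sub>0 * cmod (stieltjes_transform N \<zeta>\<^sub>0))"
proof -
  obtain c d where "stieltjes_support (stieltjes_measure N) c d l\<^sub>0"
    using stieltjes_support_stieltjes_measure[OF assms(1-4,7)] .
  then interpret stieltjes_support "stieltjes_measure N" c d l\<^sub>0 .
  have "AE x in stieltjes_measure N. indicator {0<..} x *\<^sub>R inverse (complex_of_real x - z) = inverse (complex_of_real x - z)" for z
    using AE_support by eventually_elim (use c_pos in \<open>simp add: indicator_def\<close>)
  then have St: "stieltjes_transform N z = S z" for z
    unfolding stieltjes_transform_def S_def set_lebesgue_integral_def
    by (intro integral_cong_AE) simp_all
  have St': "stieltjes_transform N = S" using St by (rule ext)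
  define G where "G = (\<lambda>\<alpha>. integral {0..1} (\<lambda>u. S (Complex l\<^sub>0 (\<eta>\<^sub>0 * u)) *
    (1 - Complex l\<^sub>0 (\<eta>\<^sub>0 * u) / of_real l\<^sub>0) powr of_real \<alpha>))"
  \<comment> \<open>The error is an exact multiple of |Re G|, so each inequality becomes an upper
    bound for |Re G|.\<close>
  have D: "cmod (complex_of_real (riesz_mean N \<alpha> l\<^sub>0)
        - 1 / (2 * complex_of_real pi * \<i>) *
          contour_integral \<Gamma> (\<lambda>\<zeta>. stieltjes_transform N \<zeta> * (1 - \<zeta> / complex_of_real l\<^sub>0) powr complex_of_real \<alpha>))
      = \<eta>\<^sub>0 / pi * \<bar>Re (G \<alpha>)\<bar>" if "\<alpha> > 0" for \<alpha>
    using riesz_difference[OF assms(4) that assms(5,6,8-11)]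
    unfolding St' riesz_mean_def set_lebesgue_integral_def G_def .
  show ?thesis
  proof (intro conjI allI impI)
    fix \<alpha> :: real assume a: "\<alpha> > 0"
    have "\<eta>\<^sub>0 / pi * \<bar>Re (G \<alpha>)\<bar> \<le> \<eta>\<^sub>0 / pi * ((\<eta>\<^sub>0 / l\<^sub>0) powr \<alpha> * cmod (S \<zeta>\<^sub>0) / \<alpha>)"
      using riesz_remainder_bound[OF assms(4) a assms(5)] assms(5)
      unfolding G_def assms(6) by (intro mult_left_mono) auto
    also have "\<dots> = 1 / (\<alpha> * pi) * (\<eta>\<^sub>0 / l\<^sub>0) powr \<alpha> * \<eta>\<^sub>0 * cmod (S \<zeta>\<^sub>0)"
      by (simp add: mult_ac)
    finally show "cmod (complex_of_real (riesz_mean N \<alpha> l\<^sub>0)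
        - 1 / (2 * complex_of_real pi * \<i>) *
          contour_integral \<Gamma> (\<lambda>\<zeta>. stieltjes_transform N \<zeta> * (1 - \<zeta> / complex_of_real l\<^sub>0) powr complex_of_real \<alpha>))
      \<le> 1 / (\<alpha> * pi) * (\<eta>\<^sub>0 / l\<^sub>0) powr \<alpha> * \<eta>\<^sub>0 * cmod (stieltjes_transform N \<zeta>\<^sub>0)"
      unfolding D[OF a] unfolding St .
  next
    fix \<alpha> :: real assume a: "0 < \<alpha> \<and> \<alpha> < 1"
    have "\<eta>\<^sub>0 / pi * \<bar>Re (G \<alpha>)\<bar> \<le> \<eta>\<^sub>0 / pi * ((\<eta>\<^sub>0 / l\<^sub>0) powr \<alpha> * (sqrt (1 + pi\<^sup>2 / 4) * cmod (S \<zeta>\<^sub>0)))"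
      using riesz_remainder_bound_less_one[OF assms(4) conjunct1[OF a] conjunct2[OF a] assms(5)] assms(5)
      unfolding G_def assms(6) by (intro mult_left_mono) auto
    also have "\<dots> = (sqrt (1 + pi\<^sup>2 / 4) / pi) * (\<eta>\<^sub>0 / l\<^sub>0) powr \<alpha> * \<eta>\<^sub>0 * cmod (S \<zeta>\<^sub>0)"
      by (simp add: mult_ac)
    also have "sqrt (1 + pi\<^sup>2 / 4) / pi = sqrt ((1 + pi\<^sup>2 / 4) / pi\<^sup>2)"
      by (simp add: real_sqrt_divide)
    also have "(1 + pi\<^sup>2 / 4) / pi\<^sup>2 = 1 / pi\<^sup>2 + 1 / 4"
      by (simp add: add_divide_distrib)
    finally show "cmod (complex_of_real (riesz_mean N \<alpha> l\<^sub>0)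
        - 1 / (2 * complex_of_real pi * \<i>) *
          contour_integral \<Gamma> (\<lambda>\<zeta>. stieltjes_transform N \<zeta> * (1 - \<zeta> / complex_of_real l\<^sub>0) powr complex_of_real \<alpha>))
      \<le> sqrt (1 / pi\<^sup>2 + 1 / 4) * (\<eta>\<^sub>0 / l\<^sub>0) powr \<alpha> * \<eta>\<^sub>0 * cmod (stieltjes_transform N \<zeta>\<^sub>0)"
      unfolding D[OF conjunct1[OF a]] unfolding St .
  qed
qed

end
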